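(* If every locally finite graph has a well-balanced orientation, then every graph (of arbitrary cardinality, possibly with parallel edges, without loops) has a well-balanced orientation.
   Context: For distinct vertices $u,v$ of a graph $G$, $\lambda_G(u,v)$ denotes the minimum cardinality of a set of edges meeting every $u$–$v$ path; for an orientation $\overrightarrow{G}$, $\overrightarrow{\lambda}_G(u,v)$ denotes the minimum cardinality of a set of edges meeting every directed path from $u$ to $v$. An orientation $\overrightarrow{G}$ is well-balanced if for all distinct vertices $u,v$ one has $\overrightarrow{\lambda}_G(u,v)\geq\lfloor\frac12\lambda_G(u,v)\rfloor$, where for an infinite cardinal $\kappa$ one sets $\lfloor\frac12\kappa\rfloor=\kappa$. *)

theory Defs
  imports Complex_Main "HOL-Library.Infinite_Typeclass" "Graph_Theory.Arc_Walk"
begin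

unbundle cardinal_syntax

section \<open>Graphs\<close>

text \<open>
  Undirected graphs of arbitrary cardinality. Edges are abstract objects with an incidence
  function, so distinct edges may have the same ends; loops are excluded.
\<close>

record ('v, 'e) multigraph =
  vertices :: "'v set"
  edges :: "'e set"
  ends :: "'e \<Rightarrow> 'v set"

definition loopless_multigraph :: "('v, 'e) multigraph \<Rightarrow> bool" where
  "loopless_multigraph G \<longleftrightarrow> (\<forall>e\<in>edges G. ends G e \<subseteq> vertices G \<and> card (ends G e) = 2)"

definition locally_finite :: "('v, 'e) multigraph \<Rightarrow> bool" where
  "locally_finite G \<longleftrightarrow> (\<forall>v\<in>vertices G. finite {e \<in> edges G. v \<in> ends G e})"

definition is_path :: "('v, 'e) multigraph \<Rightarrow> 'v \<Rightarrow> 'v list \<Rightarrow> 'e list \<Rightarrow> 'v \<Rightarrow> bool" where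
  "is_path G u xs es v \<longleftrightarrow>
     length xs = length es + 1 \<and> hd xs = u \<and> last xs = v \<and>
     distinct xs \<and> set xs \<subseteq> vertices G \<and> set es \<subseteq> edges G \<and>
     (\<forall>i<length es. ends G (es ! i) = {xs ! i, xs ! (i + 1)})"

definition is_orientation :: "('v, 'e) multigraph \<Rightarrow> ('v, 'e) pre_digraph \<Rightarrow> bool" where
  "is_orientation G D \<longleftrightarrow>
     verts D = vertices G \<and> arcs D = edges G \<and>
     (\<forall>e\<in>edges G. {tail D e, head D e} = ends G e)"

section \<open>Cardinals\<close>

text \<open>
  The least cardinality of a member of a nonempty family of sets. Like all cardinals in HOL it is
  a well-order, meaningful only up to \<open>=o\<close>; see \<open>min_card_le\<close> and \<open>min_card_attained\<close>.
\<close>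

definition min_card :: "'a set set \<Rightarrow> 'a rel" where
  "min_card F = |SOME S. S \<in> F \<and> (\<forall>T\<in>F. |S| \<le>o |T| )|"

text \<open>
  A finite cardinal is halved and rounded down, an infinite one is left unchanged. The half is
  represented by a subset of the field, again determined only up to \<open>=o\<close>.
\<close>

definition floor_half :: "'a rel \<Rightarrow> 'a rel" where
  "floor_half \<kappa> =
     (if finite (Field \<kappa>)
      then |SOME A. A \<subseteq> Field \<kappa> \<and> card A = card (Field \<kappa>) div 2|
      else \<kappa>)"

lemma min_card_ex:
  assumes "F \<noteq> {}"
  shows "\<exists>S. S \<in> F \<and> (\<forall>T\<in>F. |S| \<le>o |T| )"
proof -
  have "card_of ` F \<noteq> {}" "\<forall>r\<in>card_of ` F. Card_order r"
    using assms card_of_Card_order by auto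
  from exists_minim_Card_order[OF this] show ?thesis by auto
qed

lemma min_card_attained:
  assumes "F \<noteq> {}"
  shows "\<exists>S\<in>F. min_card F = |S|"
  using someI_ex[OF min_card_ex[OF assms]] unfolding min_card_def by blast

lemma min_card_le:
  assumes "T \<in> F"
  shows "min_card F \<le>o |T|"
  using someI_ex[OF min_card_ex[of F]] assms unfolding min_card_def by blast

lemma floor_half_finite:
  fixes A :: "'a set"
  assumes "finite A"
  shows "\<exists>B. floor_half |A| = |B| \<and> finite B \<and> card B = card A div 2"
proof -
  have "\<exists>B. B \<subseteq> Field |A| \<and> card B = card (Field |A| ) div 2"
    by (metis Field_card_of assms div_le_dividend obtain_subset_with_card_n)
  from someI_ex[OF this] show ?thesis
    using assms by (auto simp: floor_half_def Field_card_of intro: finite_subset)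
qed

lemma floor_half_infinite: "infinite A \<Longrightarrow> floor_half |A| = |A|"
  by (simp add: floor_half_def Field_card_of)

section \<open>Edge-connectivity and well-balanced orientations\<close>

definition edge_separates :: "('v, 'e) multigraph \<Rightarrow> 'v \<Rightarrow> 'v \<Rightarrow> 'e set \<Rightarrow> bool" where
  "edge_separates G u v S \<longleftrightarrow>
     S \<subseteq> edges G \<and> (\<forall>xs es. is_path G u xs es v \<longrightarrow> S \<inter> set es \<noteq> {})"

definition arc_separates :: "('v, 'e) pre_digraph \<Rightarrow> 'v \<Rightarrow> 'v \<Rightarrow> 'e set \<Rightarrow> bool" where
  "arc_separates D u v S \<longleftrightarrow>
     S \<subseteq> arcs D \<and> (\<forall>p. pre_digraph.apath D u p v \<longrightarrow> S \<inter> set p \<noteq> {})"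

text \<open>For \<open>u \<noteq> v\<close> separating sets exist: the set of all edges is one.\<close>

definition edge_conn :: "('v, 'e) multigraph \<Rightarrow> 'v \<Rightarrow> 'v \<Rightarrow> 'e rel" where
  "edge_conn G u v = min_card {S. edge_separates G u v S}"

definition arc_conn :: "('v, 'e) pre_digraph \<Rightarrow> 'v \<Rightarrow> 'v \<Rightarrow> 'e rel" where
  "arc_conn D u v = min_card {S. arc_separates D u v S}"

lemma edge_separates_edges:
  assumes "u \<noteq> v"
  shows "edge_separates G u v (edges G)"
proof -
  have "edges G \<inter> set es \<noteq> {}" if path: "is_path G u xs es v" for xs es
  proof -
    have "es \<noteq> []"
    proof
      assume "es = []"
      then obtain x where "xs = [x]"
        using path by (cases xs) (auto simp: is_path_def)
      then show False using path assms by (auto simp: is_path_def)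
    qed
    then show ?thesis
      using path by (cases es) (auto simp: is_path_def)
  qed
  then show ?thesis by (simp add: edge_separates_def)
qed

lemma arc_separates_arcs:
  assumes "u \<noteq> v"
  shows "arc_separates D u v (arcs D)"
proof -
  have "arcs D \<inter> set p \<noteq> {}" if "pre_digraph.apath D u p v" for p
    using that assms
    by (cases p) (auto simp: pre_digraph.apath_def pre_digraph.awalk_def pre_digraph.cas.simps)
  then show ?thesis by (simp add: arc_separates_def)
qed

definition well_balanced :: "('v, 'e) multigraph \<Rightarrow> ('v, 'e) pre_digraph \<Rightarrow> bool" where
  "well_balanced G D \<longleftrightarrow>
     (\<forall>u\<in>vertices G. \<forall>v\<in>vertices G. u \<noteq> v \<longrightarrow>
        floor_half (edge_conn G u v) \<le>o arc_conn D u v)"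

definition has_well_balanced_orientation :: "('v, 'e) multigraph \<Rightarrow> bool" where
  "has_well_balanced_orientation G \<longleftrightarrow> (\<exists>D. is_orientation G D \<and> well_balanced G D)"

text \<open>
  A HOL formula cannot quantify over types, so ``every locally finite graph'' is rendered as
  ``every locally finite graph whose vertices and edges are taken from two given types'', where
  the two types are arbitrary infinite ones, unrelated to the types of the graph in the
  conclusion. They must be infinite, as otherwise only finite graphs would be covered. They may
  be chosen as large as desired; for each choice the rendered assumption follows from the
  unrestricted one.
\<close>

end

theory Submission
  imports Defs "HOL-Library.Countable_Set_Type"
begin

text \<open>
  Everything is expressed through cuts. An orientation is well-balanced as soon as every vertex
  set \<open>X\<close> containing \<open>u\<close> but not \<open>v\<close> has enough outgoing edges.

  Call a subgraph faithful if a finite set of its edges that separates two vertices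
  of one of its components within it also separates them in the whole graph. Every graph
  decomposes into countable faithful subgraphs, by induction on the number \<open>\<kappa>\<close> of edges: exhaust
  the edge set by a continuous chain of sets of fewer than \<open>\<kappa>\<close> edges, closed under connecting
  paths and under the first \<open>\<alpha>\<close> edges of minimum cuts at stage \<open>\<alpha>\<close>. Then any two vertices touched at stage \<open>\<alpha>\<close> are disconnected or
  infinitely edge-connected in the rest, so the successive differences are faithful.

  A countable graph becomes locally finite by replacing vertices by rays of growing thickness;
  contracting the rays again turns a well-balanced orientation into a well-balanced one.

  Finally, orient all pieces separately. A pair with finite connectivity \<open>k\<close> is joined by a chain
  of pairs that are \<open>k\<close>-edge-connected inside one piece, and \<open>X\<close> separates one of these. If the
  connectivity is an uncountable \<open>\<kappa>\<close>, then \<open>X\<close> cuts at least \<open>\<kappa>\<close> non-bridges; these meet \<open>\<kappa>\<close>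
  pieces, and each such piece has an edge leaving \<open>X\<close>.
\<close>

section \<open>Cuts and faithful subgraphs\<close>

definition cut_edges :: "('e \<Rightarrow> 'v set) \<Rightarrow> 'v set \<Rightarrow> 'e set" where
  "cut_edges en X = {e. en e \<inter> X \<noteq> {} \<and> en e - X \<noteq> {}}"

text \<open>Connectedness by walks in \<open>A\<close>, in dual form: no vertex set that is
  uncrossed by \<open>A\<close> tells \<open>x\<close> from \<open>y\<close>. Walks themselves enter
  only when the result is translated back to paths.\<close>

definition conn :: "('e \<Rightarrow> 'v set) \<Rightarrow> 'e set \<Rightarrow> 'v \<Rightarrow> 'v \<Rightarrow> bool" where
  "conn en A x y \<longleftrightarrow> (\<forall>X. A \<inter> cut_edges en X = {} \<longrightarrow> (x \<in> X \<longleftrightarrow> y \<in> X))"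

definition component :: "('e \<Rightarrow> 'v set) \<Rightarrow> 'e set \<Rightarrow> 'v \<Rightarrow> 'v set" where
  "component en A x = {z. conn en A x z}"

definition faithful :: "('e \<Rightarrow> 'v set) \<Rightarrow> 'e set \<Rightarrow> 'e set \<Rightarrow> bool" where
  "faithful en A B \<longleftrightarrow> A \<subseteq> B \<and>
     (\<forall>x y F. conn en A x y \<longrightarrow> finite F \<longrightarrow> F \<subseteq> A \<longrightarrow> conn en (B - F) x y \<longrightarrow> conn en (A - F) x y)"

lemma cut_edges_Compl: "cut_edges en (- X) = cut_edges en X"
  by (auto simp: cut_edges_def)

lemma cut_edgesI: "a \<in> en e \<Longrightarrow> b \<in> en e \<Longrightarrow> a \<in> X \<Longrightarrow> b \<notin> X \<Longrightarrow> e \<in> cut_edges en X"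
  by (auto simp: cut_edges_def)

lemma cut_edgesE:
  assumes "e \<in> cut_edges en X"
  obtains a b where "a \<in> en e" "b \<in> en e" "a \<in> X" "b \<notin> X"
  using assms by (auto simp: cut_edges_def)

lemma conn_refl [simp]: "conn en A x x"
  by (simp add: conn_def)

lemma conn_sym: "conn en A x y \<Longrightarrow> conn en A y x"
  by (simp add: conn_def)

lemma conn_trans: "conn en A x y \<Longrightarrow> conn en A y z \<Longrightarrow> conn en A x z"
  by (simp add: conn_def)

lemma conn_mono: "conn en A x y \<Longrightarrow> A \<subseteq> B \<Longrightarrow> conn en B x y"
  unfolding conn_def by blast

lemma conn_edge: "e \<in> A \<Longrightarrow> a \<in> en e \<Longrightarrow> b \<in> en e \<Longrightarrow> conn en A a b"
  unfolding conn_def cut_edges_def by blast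

lemma not_connE:
  assumes "\<not> conn en A x y"
  obtains X where "A \<inter> cut_edges en X = {}" "x \<in> X" "y \<notin> X"
proof -
  obtain X where X: "A \<inter> cut_edges en X = {}" "(x \<in> X) \<noteq> (y \<in> X)"
    using assms by (auto simp: conn_def)
  show ?thesis
  proof (cases "x \<in> X")
    case True then show ?thesis using X that by blast
  next
    case False
    then show ?thesis using X that[of "- X"] by (auto simp: cut_edges_Compl)
  qed
qed

lemma conn_crosses:
  assumes "conn en A x y" "x \<in> X" "y \<notin> X"
  shows "\<exists>e \<in> A. e \<in> cut_edges en X"
  using assms unfolding conn_def by blast

lemma component_closed: "A \<inter> cut_edges en (component en A x) = {}"
proof -
  have "e \<notin> cut_edges en (component en A x)" if "e \<in> A" for e
  proof
    assume "e \<in> cut_edges en (component en A x)"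
    then obtain a b where "a \<in> en e" "b \<in> en e" "a \<in> component en A x" "b \<notin> component en A x"
      by (rule cut_edgesE)
    then have "conn en A x b"
      unfolding component_def mem_Collect_eq by (blast intro: conn_trans[OF _ conn_edge[OF that]])
    with \<open>b \<notin> component en A x\<close> show False by (simp add: component_def)
  qed
  then show ?thesis by blast
qed

text \<open>The vertices joined to \<open>x\<close> by a finite subset of \<open>A\<close> form a
  set that no edge of \<open>A\<close> crosses. This takes the place of the finiteness of
  paths.\<close>

lemma conn_finite:
  assumes "conn en A x y"
  shows "\<exists>P. finite P \<and> P \<subseteq> A \<and> conn en P x y"
proof -
  define X where "X = {z. \<exists>P. finite P \<and> P \<subseteq> A \<and> conn en P x z}"
  have "e \<notin> cut_edges en X" if eA: "e \<in> A" for e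
  proof
    assume "e \<in> cut_edges en X"
    then obtain a b where ab: "a \<in> en e" "b \<in> en e" "a \<in> X" "b \<notin> X"
      by (rule cut_edgesE)
    then obtain P where P: "finite P" "P \<subseteq> A" "conn en P x a" unfolding X_def by blast
    have "conn en (insert e P) x a" using P(3) by (rule conn_mono) blast
    moreover have "conn en (insert e P) a b" using ab(1,2) by (rule conn_edge[OF insertI1])
    ultimately have "conn en (insert e P) x b" by (rule conn_trans)
    moreover have "finite (insert e P)" "insert e P \<subseteq> A" using eA P by simp_all
    ultimately have "b \<in> X" unfolding X_def by blast
    then show False using ab(4) by contradiction
  qed
  then have "A \<inter> cut_edges en X = {}" by blast
  moreover have "x \<in> X" unfolding X_def by (rule CollectI, rule exI[of _ "{}"]) simp
  ultimately have "y \<in> X" using assms unfolding conn_def by blast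
  then show ?thesis by (simp add: X_def)
qed

lemma conn_in_ends:
  assumes "conn en A x y" "x \<noteq> y"
  shows "x \<in> \<Union> (en ` A)"
proof -
  obtain e where "e \<in> A" "e \<in> cut_edges en {x}"
    using conn_crosses[OF assms(1), of "{x}"] assms(2) by blast
  then show ?thesis by (auto simp: cut_edges_def)
qed

lemma faithful_refl: "faithful en A A"
  by (simp add: faithful_def)

lemma faithful_subset: "faithful en A B \<Longrightarrow> A \<subseteq> B"
  by (simp add: faithful_def)

lemma faithfulD:
  "faithful en A B \<Longrightarrow> conn en A x y \<Longrightarrow> finite F \<Longrightarrow> F \<subseteq> A \<Longrightarrow> conn en (B - F) x y
     \<Longrightarrow> conn en (A - F) x y"
  by (simp add: faithful_def)

lemma faithful_trans:
  assumes AB: "faithful en A B" and BC: "faithful en B C"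
  shows "faithful en A C"
  unfolding faithful_def
proof (intro conjI allI impI)
  show "A \<subseteq> C" using faithful_subset[OF AB] faithful_subset[OF BC] by (rule subset_trans)
  fix x y F
  assume xy: "conn en A x y" and F: "finite F" "F \<subseteq> A" and c: "conn en (C - F) x y"
  have "conn en B x y" by (rule conn_mono[OF xy faithful_subset[OF AB]])
  then have "conn en (B - F) x y"
    using F(1) subset_trans[OF F(2) faithful_subset[OF AB]] c by (rule faithfulD[OF BC])
  with AB xy F show "conn en (A - F) x y" by (rule faithfulD)
qed

text \<open>A path that leaves \<open>E - N\<close> starts and ends, up to detours in \<open>E - N\<close>, at vertices
  touched by \<open>N\<close>; so it is enough to reconnect those.\<close>

lemma faithful_Diff:
  assumes "N \<subseteq> E"
    and "\<And>x y F. x \<in> \<Union> (en ` N) \<Longrightarrow> y \<in> \<Union> (en ` N) \<Longrightarrow> conn en (E - N) x y \<Longrightarrow> finite F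
           \<Longrightarrow> F \<subseteq> E - N \<Longrightarrow> conn en (E - N - F) x y"
  shows "faithful en (E - N) E"
  unfolding faithful_def
proof (intro conjI allI impI)
  fix x y F
  assume xy: "conn en (E - N) x y" and F: "finite F" "F \<subseteq> E - N" and c: "conn en (E - F) x y"
  let ?A = "E - N - F"
  have touch: "\<exists>x'. x' \<in> \<Union> (en ` N) \<and> conn en ?A x x'"
    if co: "conn en (E - F) x y" and nc: "\<not> conn en ?A x y" for x y
  proof -
    have "x \<in> component en ?A x" "y \<notin> component en ?A x" using nc by (simp_all add: component_def)
    then obtain e where e: "e \<in> E - F" "e \<in> cut_edges en (component en ?A x)"
      using conn_crosses[OF co] by blast
    \<comment> \<open>\<open>e\<close> leaves a component of \<open>?A\<close>, so it is not in
      \<open>?A\<close>; as it avoids \<open>F\<close>, it must lie in \<open>N\<close>.\<close>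
    then have "e \<in> N" using component_closed[of ?A en x] by blast
    moreover obtain a where "a \<in> en e" "a \<in> component en ?A x" using e(2) by (rule cut_edgesE)
    ultimately show ?thesis unfolding component_def by blast
  qed
  show "conn en (E - N - F) x y"
  proof (rule ccontr)
    assume n: "\<not> conn en ?A x y"
    obtain x' where x': "x' \<in> \<Union> (en ` N)" "conn en ?A x x'" using touch[OF c n] by blast
    obtain y' where y': "y' \<in> \<Union> (en ` N)" "conn en ?A y y'"
      using touch[OF conn_sym[OF c]] n conn_sym[of en ?A y x] by blast
    have sub: "?A \<subseteq> E - N" by blast
    have "conn en (E - N) x' y'"
      by (rule conn_trans[OF conn_sym[OF conn_mono[OF x'(2) sub]] conn_trans[OF xy conn_mono[OF y'(2) sub]]])
    then have "conn en ?A x' y'" using F by (rule assms(2)[OF x'(1) y'(1)])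
    then show False using n conn_trans[OF x'(2) conn_trans[OF _ conn_sym[OF y'(2)]]] by blast
  qed
qed (rule Diff_subset)

section \<open>Decomposition into countable faithful pieces\<close>

lemma countable_ordLeq_infinite:
  assumes "countable A" "infinite K"
  shows "|A| \<le>o |K|"
proof -
  have "|A| \<le>o |UNIV :: nat set|" using assms(1) by (simp add: countable_card_of_nat)
  moreover have "|UNIV :: nat set| \<le>o |K|" using assms(2) by (simp add: infinite_iff_card_of_nat)
  ultimately show ?thesis by (rule ordLeq_transitive)
qed

lemma countable_ordLess_uncountable:
  assumes "countable A" "uncountable K"
  shows "|A| <o |K|"
proof (rule ccontr)
  assume "\<not> |A| <o |K|"
  then have "|K| \<le>o |A|" using ordLess_or_ordLeq[OF card_of_Well_order card_of_Well_order] by blast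
  then show False using assms countable_ordLeq by blast
qed

lemma card_of_Un_ordLeq_infinite:
  assumes "infinite K" "|A| \<le>o |K|" "|B| \<le>o |K|"
  shows "|A \<union> B| \<le>o |K|"
  using card_of_Un_ordLeq_infinite_Field[of "|K|" A B] assms by (simp add: Field_card_of card_of_card_order_on)

text \<open>Sets of at most \<open>n\<close> elements are counted by induction on \<open>n\<close>,
  splitting off one element; the union over \<open>n\<close> is a countable one.\<close>

lemma card_of_Fpow_ordLeq:
  fixes K :: "'k set"
  assumes K: "infinite K" and S: "|S| \<le>o |K|"
  shows "|Fpow S| \<le>o |K|"
proof -
  define T where "T n = {F. F \<subseteq> S \<and> finite F \<and> card F \<le> n}" for n :: nat
  have T: "|T n| \<le>o |K|" for n
  proof (induction n)
    case 0
    have "T 0 \<subseteq> {{}}" by (auto simp: T_def)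
    then have "countable (T 0)" by (rule countable_subset) simp
    then show ?case using K by (rule countable_ordLeq_infinite)
  next
    case (Suc n)
    have "|\<Union>a\<in>S. insert a ` T n| \<le>o |K|"
      using K S by (rule card_of_UNION_ordLeq_infinite) (meson Suc card_of_image ordLeq_transitive)
    moreover have "|{{} :: 'b set}| \<le>o |K|" by (rule countable_ordLeq_infinite[OF _ K]) simp
    ultimately have "|{{}} \<union> (\<Union>a\<in>S. insert a ` T n)| \<le>o |K|"
      by (intro card_of_Un_ordLeq_infinite K)
    moreover have "T (Suc n) \<subseteq> {{}} \<union> (\<Union>a\<in>S. insert a ` T n)"
    proof
      fix F assume F: "F \<in> T (Suc n)"
      show "F \<in> {{}} \<union> (\<Union>a\<in>S. insert a ` T n)"
      proof (cases "F = {}")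
        case False
        then obtain a where a: "a \<in> F" by blast
        have "F - {a} \<in> T n" "a \<in> S" "F = insert a (F - {a})"
          using F a by (auto simp: T_def)
        then show ?thesis by blast
      qed simp
    qed
    ultimately show ?case by (meson card_of_mono1 ordLeq_transitive)
  qed
  have "|\<Union>n. T n| \<le>o |K|"
    using K by (rule card_of_UNION_ordLeq_infinite) (use K T in \<open>simp_all add: infinite_iff_card_of_nat\<close>)
  moreover have "Fpow S = (\<Union>n. T n)" by (auto simp: Fpow_def T_def)
  ultimately show ?thesis by simp
qed

section \<open>Closing off sets of edges\<close>

text \<open>A Loewenheim-Skolem argument: adjoin the values of \<open>h\<close> countably often. A
  finite subset of the union already lies in one stage, and the next stage contains its
  image.\<close>

lemma closed_superset_exists:
  fixes h :: "'e set \<Rightarrow> 'e set" and K :: "'k set"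
  assumes K: "infinite K" and S: "|S| \<le>o |K|" "S \<subseteq> E"
    and h: "\<And>F. finite F \<Longrightarrow> F \<subseteq> E \<Longrightarrow> h F \<subseteq> E \<and> |h F| \<le>o |K|"
  shows "\<exists>M. S \<subseteq> M \<and> M \<subseteq> E \<and> |M| \<le>o |K| \<and> (\<forall>F. finite F \<longrightarrow> F \<subseteq> M \<longrightarrow> h F \<subseteq> M)"
proof -
  define T where "T = rec_nat S (\<lambda>_ M. M \<union> (\<Union>F\<in>Fpow M. h F))"
  have T0: "T 0 = S" and TS: "T (Suc n) = T n \<union> (\<Union>F\<in>Fpow (T n). h F)" for n
    by (simp_all add: T_def)
  have T: "T n \<subseteq> E \<and> |T n| \<le>o |K|" for n
  proof (induction n)
    case 0
    then show ?case using S by (simp add: T0)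
  next
    case (Suc n)
    have hF: "h F \<subseteq> E \<and> |h F| \<le>o |K|" if "F \<in> Fpow (T n)" for F
      using that Suc by (intro h) (auto simp: Fpow_def)
    have "|\<Union>F\<in>Fpow (T n). h F| \<le>o |K|"
      using K card_of_Fpow_ordLeq[OF K] by (rule card_of_UNION_ordLeq_infinite) (use Suc hF in auto)
    then have "|T (Suc n)| \<le>o |K|"
      unfolding TS using K Suc by (intro card_of_Un_ordLeq_infinite) auto
    moreover have "T (Suc n) \<subseteq> E" using hF Suc unfolding TS by blast
    ultimately show ?case by simp
  qed
  have mono: "T m \<subseteq> T n" if "m \<le> n" for m n
    using that by (rule lift_Suc_mono_le[rotated]) (simp add: TS)
  define M where "M = (\<Union>n. T n)"
  have "h F \<subseteq> M" if "finite F" "F \<subseteq> M" for F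
  proof -
    have "\<exists>n. F \<subseteq> T n"
      using that
    proof (induction F)
      case (insert a F)
      then obtain n where n: "F \<subseteq> T n" by blast
      obtain m where m: "a \<in> T m" using insert.prems by (auto simp: M_def)
      have "insert a F \<subseteq> T (max m n)"
        using n m mono[of m "max m n"] mono[of n "max m n"] by auto
      then show ?case by blast
    qed simp
    then obtain n where "F \<subseteq> T n" by blast
    then have "h F \<subseteq> T (Suc n)" using that(1) unfolding TS Fpow_def by blast
    then show ?thesis unfolding M_def by blast
  qed
  moreover have "|M| \<le>o |K|"
    unfolding M_def using K by (rule card_of_UNION_ordLeq_infinite) (use K T in \<open>simp_all add: infinite_iff_card_of_nat\<close>)
  moreover have "S \<subseteq> M" using T0 unfolding M_def by blast
  moreover have "M \<subseteq> E" using T unfolding M_def by blast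
  ultimately show ?thesis by blast
qed

text \<open>This makes "the first \<open>\<alpha>\<close> edges of \<open>C\<close>" meaningful for every stage \<open>\<alpha>\<close> of the chain, also
  when \<open>|E|\<close> is singular or a limit cardinal.\<close>

lemma enumeration_exists:
  assumes "C \<subseteq> E"
  shows "\<exists>g. inj_on g C \<and> g ` C \<subseteq> E \<and> (\<forall>c\<in>C. |underS |E| (g c)| <o |C| )"
proof -
  have "|C| \<le>o |E|" using assms by (rule card_of_mono1)
  then obtain g where g: "embed |C| |E| g" unfolding ordLeq_def by auto
  have W: "Well_order |C|" by (rule card_of_Well_order)
  have "inj_on g C" using embed_inj_on[OF W g] by (simp add: Field_card_of)
  moreover have "g ` C \<subseteq> E" using embed_Field[OF g] by (simp add: Field_card_of)
  moreover have "|underS |E| (g c)| <o |C|" if c: "c \<in> C" for c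
  proof -
    have "bij_betw g (underS |C| c) (underS |E| (g c))"
      using embed_underS[OF W g] c by (simp add: Field_card_of)
    then have "|underS |C| c| =o |underS |E| (g c)|" by (rule card_of_ordIsoI)
    moreover have "|underS |C| c| <o |C|"
      using c by (intro card_of_underS card_of_Card_order) (simp add: Field_card_of)
    ultimately show ?thesis using ordIso_ordLess_trans ordIso_symmetric by blast
  qed
  ultimately show ?thesis by blast
qed

text \<open>Faithfulness comes from closing under finite connecting sets: if \<open>x\<close> and
  \<open>y\<close> stay connected in \<open>E - N\<close> after removing finitely many edges of
  \<open>M - N\<close>, then a connecting set chosen in advance lies in \<open>M\<close>. The
  parameter \<open>W\<close> serves to feed in parts of minimum cuts.\<close>

lemma faithful_extension_exists:
  fixes en :: "'e \<Rightarrow> 'v set"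
  assumes fin: "\<And>e. e \<in> E \<Longrightarrow> finite (en e)"
    and K: "infinite K" and S: "|S| \<le>o |K|" "S \<subseteq> E"
    and W: "\<And>x y. W x y \<subseteq> E \<and> |W x y| \<le>o |K|"
  shows "\<exists>M. S \<subseteq> M \<and> M \<subseteq> E \<and> |M| \<le>o |K| \<and> faithful en (M - N) (E - N) \<and>
    (\<forall>x\<in>\<Union> (en ` M). \<forall>y\<in>\<Union> (en ` M). W x y \<subseteq> M)"
proof -
  define p where "p F x y = (SOME P. finite P \<and> P \<subseteq> E - N - F \<and> conn en P x y)" for F x y
  have p: "finite (p F x y) \<and> p F x y \<subseteq> E - N - F \<and> conn en (p F x y) x y"
    if "conn en (E - N - F) x y" for F x y
    unfolding p_def by (rule someI_ex) (rule conn_finite[OF that])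
  \<comment> \<open>Where no connecting set exists, the choice \<open>p\<close> is arbitrary; the
    default \<open>{}\<close> keeps \<open>h\<close> inside \<open>E\<close> and its values
    small.\<close>
  define q where "q F x y = (if conn en (E - N - F) x y then p F x y else {})" for F x y
  have q: "finite (q F x y) \<and> q F x y \<subseteq> E" for F x y
    using p[of F x y] by (auto simp: q_def)
  \<comment> \<open>One finite set carries all arguments: \<open>x\<close> and \<open>y\<close>
    range over the ends of its edges, and the removed set \<open>F'\<close> over its
    subsets.\<close>
  define h where "h F = (\<Union>x\<in>\<Union> (en ` F). \<Union>y\<in>\<Union> (en ` F). W x y \<union> (\<Union>F'\<in>Pow F. q F' x y))" for F
  have hE: "h F \<subseteq> E \<and> |h F| \<le>o |K|" if F: "finite F" "F \<subseteq> E" for F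
  proof
    show "h F \<subseteq> E" using W q unfolding h_def by blast
    have V: "|\<Union> (en ` F)| \<le>o |K|"
      using F fin by (intro countable_ordLeq_infinite K countable_finite) auto
    have "|W x y \<union> (\<Union>F'\<in>Pow F. q F' x y)| \<le>o |K|" for x y
    proof -
      have "finite (\<Union>F'\<in>Pow F. q F' x y)" using F(1) q by simp
      then have "|\<Union>F'\<in>Pow F. q F' x y| \<le>o |K|"
        by (intro countable_ordLeq_infinite K countable_finite)
      then show ?thesis using W by (intro card_of_Un_ordLeq_infinite K) auto
    qed
    then show "|h F| \<le>o |K|"
      unfolding h_def by (intro card_of_UNION_ordLeq_infinite K V ballI)
  qed
  have "\<exists>M. S \<subseteq> M \<and> M \<subseteq> E \<and> |M| \<le>o |K| \<and> (\<forall>F. finite F \<longrightarrow> F \<subseteq> M \<longrightarrow> h F \<subseteq> M)"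
    using K S hE by (rule closed_superset_exists)
  then obtain M where "S \<subseteq> M \<and> M \<subseteq> E \<and> |M| \<le>o |K| \<and> (\<forall>F. finite F \<longrightarrow> F \<subseteq> M \<longrightarrow> h F \<subseteq> M)" ..
  then have M: "S \<subseteq> M" "M \<subseteq> E" "|M| \<le>o |K|"
    and cl: "\<And>F. finite F \<Longrightarrow> F \<subseteq> M \<Longrightarrow> h F \<subseteq> M" by simp_all
  have WM: "W x y \<subseteq> M" if xy: "x \<in> \<Union> (en ` M)" "y \<in> \<Union> (en ` M)" for x y
  proof -
    obtain a b where ab: "a \<in> M" "b \<in> M" "x \<in> en a" "y \<in> en b" using xy by blast
    then have "h {a, b} \<subseteq> M" by (intro cl) auto
    moreover have "W x y \<subseteq> h {a, b}" using ab unfolding h_def by blast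
    ultimately show ?thesis by blast
  qed
  have "conn en (M - N - F) x y"
    if xy: "conn en (M - N) x y" and F: "finite F" "F \<subseteq> M - N" and c: "conn en (E - N - F) x y" for x y F
  proof (cases "x = y")
    case False
    obtain a where a: "a \<in> M - N" "x \<in> en a"
      using conn_in_ends[OF xy False] by blast
    obtain b where b: "b \<in> M - N" "y \<in> en b"
      using conn_in_ends[OF conn_sym[OF xy] False[symmetric]] by blast
    \<comment> \<open>The edges \<open>a\<close> and \<open>b\<close> are adjoined so that
      \<open>x\<close> and \<open>y\<close> become admissible arguments of \<open>h\<close>.\<close>
    have "h (insert a (insert b F)) \<subseteq> M" using F a b by (intro cl) auto
    moreover have "q F x y \<subseteq> h (insert a (insert b F))"
    proof -
      have "x \<in> \<Union> (en ` insert a (insert b F))" "y \<in> \<Union> (en ` insert a (insert b F))"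
        "F \<in> Pow (insert a (insert b F))" using a b by auto
      then show ?thesis unfolding h_def by blast
    qed
    ultimately have "q F x y \<subseteq> M" by blast
    then have "p F x y \<subseteq> M - N - F" "conn en (p F x y) x y"
      using p[OF c] c by (auto simp: q_def)
    then show ?thesis by (metis conn_mono)
  qed simp
  then have fa: "faithful en (M - N) (E - N)"
    unfolding faithful_def using M(2) by blast
  show ?thesis by (intro exI[of _ M] conjI ballI M fa WM)
qed

section \<open>Minimum cuts and the transfinite chain\<close>

text \<open>A least separating edge set, finite or infinite. For \<open>x = y\<close> nothing
  separates, and the value is arbitrary.\<close>

definition min_cut :: "('e \<Rightarrow> 'v set) \<Rightarrow> 'e set \<Rightarrow> 'v \<Rightarrow> 'v \<Rightarrow> 'e set" where
  "min_cut en E x y = (SOME C. C \<subseteq> E \<and> \<not> conn en (E - C) x y \<and>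
     (\<forall>T. T \<subseteq> E \<and> \<not> conn en (E - T) x y \<longrightarrow> |C| \<le>o |T| ))"

lemma min_cut:
  assumes "x \<noteq> y"
  shows "min_cut en E x y \<subseteq> E" "\<not> conn en (E - min_cut en E x y) x y"
    "T \<subseteq> E \<Longrightarrow> \<not> conn en (E - T) x y \<Longrightarrow> |min_cut en E x y| \<le>o |T|"
proof -
  have "\<not> conn en (E - E) x y" using conn_in_ends[OF _ assms, of en "{}"] by auto
  then have "{C. C \<subseteq> E \<and> \<not> conn en (E - C) x y} \<noteq> {}" by blast
  from min_card_ex[OF this]
  have "\<exists>C. C \<subseteq> E \<and> \<not> conn en (E - C) x y \<and> (\<forall>T. T \<subseteq> E \<and> \<not> conn en (E - T) x y \<longrightarrow> |C| \<le>o |T| )"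
    by simp
  from someI_ex[OF this, folded min_cut_def]
  show "min_cut en E x y \<subseteq> E" "\<not> conn en (E - min_cut en E x y) x y"
    "T \<subseteq> E \<Longrightarrow> \<not> conn en (E - T) x y \<Longrightarrow> |min_cut en E x y| \<le>o |T|"
    by simp_all
qed

text \<open>Let \<open>N\<close> touch both \<open>x\<close> and \<open>y\<close>, connected in
  \<open>E - N\<close>. Their minimum cut cannot lie inside \<open>N\<close>, so it has more than
  \<open>|K|\<close> edges; then \<open>N \<union> F\<close> with \<open>F\<close> finite is too
  small to separate them.\<close>

lemma faithful_Diff_min_cut:
  assumes N: "N \<subseteq> E" "|N| \<le>o |K|" and K: "infinite K"
    and C: "\<And>x y. x \<in> \<Union> (en ` N) \<Longrightarrow> y \<in> \<Union> (en ` N) \<Longrightarrow> x \<noteq> y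
      \<Longrightarrow> min_cut en E x y \<subseteq> N \<or> |K| <o |min_cut en E x y|"
  shows "faithful en (E - N) E"
proof (rule faithful_Diff[OF N(1)])
  fix x y F
  assume xy: "x \<in> \<Union> (en ` N)" "y \<in> \<Union> (en ` N)" "conn en (E - N) x y" and F: "finite F" "F \<subseteq> E - N"
  show "conn en (E - N - F) x y"
  proof (rule ccontr)
    assume n: "\<not> conn en (E - N - F) x y"
    then have ne: "x \<noteq> y" by auto
    from C[OF xy(1,2) ne] show False
    proof
      assume "min_cut en E x y \<subseteq> N"
      then have "conn en (E - min_cut en E x y) x y" by (intro conn_mono[OF xy(3)]) blast
      then show False using min_cut(2)[OF ne] by blast
    next
      assume less: "|K| <o |min_cut en E x y|"
      have "N \<union> F \<subseteq> E" "\<not> conn en (E - (N \<union> F)) x y"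
        using N(1) F n by (auto simp: Diff_eq Int_assoc)
      then have "|min_cut en E x y| \<le>o |N \<union> F|" by (rule min_cut(3)[OF ne])
      moreover have "|F| \<le>o |K|"
        using F(1) by (intro countable_ordLeq_infinite K countable_finite)
      then have "|N \<union> F| \<le>o |K|" by (rule card_of_Un_ordLeq_infinite[OF K N(2)])
      ultimately have "|min_cut en E x y| \<le>o |K|" by (rule ordLeq_transitive)
      then show False using less not_ordLess_ordLeq by blast
    qed
  qed
qed

lemma underS_card_of:
  fixes E :: "'e set"
  shows "wf ( |E| - Id)"
    and "a \<in> underS |E| b \<Longrightarrow> a \<in> E \<and> b \<in> E \<and> a \<noteq> b"
    and "a \<in> underS |E| b \<Longrightarrow> b \<in> underS |E| c \<Longrightarrow> a \<in> underS |E| c"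
    and "a \<in> E \<Longrightarrow> b \<in> E \<Longrightarrow> a = b \<or> a \<in> underS |E| b \<or> b \<in> underS |E| a"
proof -
  have W: "Well_order |E|" by (rule card_of_Well_order)
  show "wf ( |E| - Id)" using W by (simp add: well_order_on_def)
  have F: "Field |E| = E" by (rule Field_card_of)
  show "a \<in> underS |E| b \<Longrightarrow> a \<in> E \<and> b \<in> E \<and> a \<noteq> b"
    using F by (auto simp: underS_def Field_def)
  have lin: "trans |E|" "antisym |E|" "total_on E |E|"
    using W F by (simp_all add: well_order_on_def linear_order_on_def partial_order_on_def preorder_on_def)
  show "a \<in> underS |E| b \<Longrightarrow> b \<in> underS |E| c \<Longrightarrow> a \<in> underS |E| c"
    using lin(1,2) unfolding underS_def trans_def antisym_def by blast
  show "a \<in> E \<Longrightarrow> b \<in> E \<Longrightarrow> a = b \<or> a \<in> underS |E| b \<or> b \<in> underS |E| a"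
    using lin(3) unfolding underS_def total_on_def by blast
qed

text \<open>One round of the decomposition: an increasing chain \<open>f a\<close> is indexed by the
  edges \<open>a\<close> in the well-order \<open>|E|\<close>, and its successive differences
  \<open>D a\<close> are the pieces. As \<open>|E|\<close> is a cardinal, proper initial segments,
  and with them the stages, are smaller than \<open>E\<close>.\<close>

lemma small_faithful_partition:
  fixes en :: "'e \<Rightarrow> 'v set"
  assumes fin: "\<And>e. e \<in> E \<Longrightarrow> finite (en e)" and unc: "uncountable E"
  shows "\<exists>D. (\<Union>a\<in>E. D a) = E \<and> (\<forall>a\<in>E. \<forall>b\<in>E. a \<noteq> b \<longrightarrow> D a \<inter> D b = {}) \<and>
    (\<forall>a\<in>E. |D a| <o |E| \<and> faithful en (D a) E)"
proof -
  define L where "L a = underS |E| a" for a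
  have LE: "a \<in> E" "b \<in> E" "a \<noteq> b" if "a \<in> L b" for a b
    using underS_card_of(2) that unfolding L_def by metis+
  have Ltrans: "a \<in> L c" if "a \<in> L b" "b \<in> L c" for a b c
    using underS_card_of(3) that unfolding L_def by metis
  have Llin: "a = b \<or> a \<in> L b \<or> b \<in> L a" if "a \<in> E" "b \<in> E" for a b
    using underS_card_of(4) that unfolding L_def by metis
  have Lmax: "\<exists>m\<in>L a. b \<in> insert m (L m) \<and> c \<in> insert m (L m)" if bc: "b \<in> L a" "c \<in> L a" for a b c
    using Llin[of b c] LE[OF bc(1)] LE[OF bc(2)] bc by blast
  have infE: "infinite E" using unc countable_finite by blast
  then obtain Z where Z: "Z \<subseteq> E" "countable Z" "infinite Z" using infinite_countable_subset' by metis
  \<comment> \<open>\<open>Z\<close> pads short initial segments, so that \<open>K a\<close> is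
    infinite from the first stage on.\<close>
  define K where "K a = Z \<union> insert a (L a)" for a
  have Kinf: "infinite (K a)" for a using Z(3) by (simp add: K_def)
  define C where "C = min_cut en E"
  define g where "g x y = (SOME g. inj_on g (C x y) \<and> g ` C x y \<subseteq> E \<and> (\<forall>c\<in>C x y. |L (g c)| <o |C x y| ))" for x y
  have g: "inj_on (g x y) (C x y) \<and> g x y ` C x y \<subseteq> E \<and> (\<forall>c\<in>C x y. |L (g x y c)| <o |C x y| )"
    if "x \<noteq> y" for x y
  proof -
    have "C x y \<subseteq> E" unfolding C_def by (rule min_cut(1)[OF that])
    from enumeration_exists[OF this] show ?thesis unfolding g_def L_def by (rule someI_ex)
  qed
  \<comment> \<open>The part of a minimum cut to be absorbed: the edges with index in
    \<open>A\<close>, or the whole cut at once if it is countable.\<close>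
  define W where "W A x y = (if x = y then {} else {c \<in> C x y. countable (C x y) \<or> g x y c \<in> A})" for A x y
  have W: "W (insert a (L a)) x y \<subseteq> E \<and> |W (insert a (L a)) x y| \<le>o |K a|" for a x y
  proof (cases "x = y")
    case True
    then show ?thesis by (simp add: W_def card_of_empty)
  next
    case False
    have "W (insert a (L a)) x y \<subseteq> C x y" using False by (auto simp: W_def)
    moreover have "C x y \<subseteq> E" unfolding C_def by (rule min_cut(1)[OF False])
    moreover have "|W (insert a (L a)) x y| \<le>o |K a|"
    proof (cases "countable (C x y)")
      case True
      then show ?thesis using calculation(1) by (intro countable_ordLeq_infinite Kinf) (rule countable_subset)
    next
      case unc: False
      have "inj_on (g x y) (W (insert a (L a)) x y)"
        using g[OF False] calculation(1) inj_on_subset by blast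
      moreover have "g x y ` W (insert a (L a)) x y \<subseteq> K a"
        using unc False by (auto simp: W_def K_def)
      ultimately show ?thesis using card_of_ordLeq by blast
    qed
    ultimately show ?thesis by blast
  qed
  \<comment> \<open>\<open>N f a\<close> collects all stages before \<open>a\<close>, which is the
    continuous value of the chain at limits; \<open>f a\<close> then enlarges it by one closure
    step.\<close>
  define N where "N f a = \<Union> (f ` L a)" for f :: "'e \<Rightarrow> 'e set" and a
  define Q where "Q f a M \<longleftrightarrow> (a \<in> E \<longrightarrow> insert a (N f a) \<subseteq> M \<and> M \<subseteq> E \<and> |M| \<le>o |K a| \<and>
    faithful en (M - N f a) (E - N f a) \<and>
    (\<forall>x\<in>\<Union> (en ` M). \<forall>y\<in>\<Union> (en ` M). W (insert a (L a)) x y \<subseteq> M))" for f a M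
  \<comment> \<open>Transfinite recursion: \<open>Q f a M\<close> depends on \<open>f\<close> only
    below \<open>a\<close>.\<close>
  have "\<exists>f. \<forall>a. Q f a (f a)"
  proof (rule dependent_wf_choice[OF underS_card_of(1)])
    fix f g :: "'e \<Rightarrow> 'e set" and a M
    assume "\<And>b. (b, a) \<in> |E| - Id \<Longrightarrow> f b = g b"
    then have "N f a = N g a" unfolding N_def by (intro arg_cong[where f=Union] image_cong) (auto simp: L_def underS_def)
    then show "Q f a M = Q g a M" by (simp add: Q_def)
  next
    fix a f
    assume IH: "\<And>b. (b, a) \<in> |E| - Id \<Longrightarrow> Q f b (f b)"
    show "\<exists>M. Q f a M"
    proof (cases "a \<in> E")
      case True
      have f: "f b \<subseteq> E \<and> |f b| \<le>o |K b|" if b: "b \<in> L a" for b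
      proof -
        have "Q f b (f b)" using b by (intro IH) (auto simp: L_def underS_def)
        then show ?thesis using LE(1)[OF b] by (simp add: Q_def)
      qed
      have fK: "|f b| \<le>o |K a|" if b: "b \<in> L a" for b
      proof -
        have "K b \<subseteq> K a" unfolding K_def using b Ltrans by blast
        then have "|K b| \<le>o |K a|" by (rule card_of_mono1)
        with f[OF b] show ?thesis using ordLeq_transitive by blast
      qed
      have "|L a| \<le>o |K a|" by (rule card_of_mono1) (auto simp: K_def)
      then have "|N f a| \<le>o |K a|"
        unfolding N_def using fK by (intro card_of_UNION_ordLeq_infinite Kinf) auto
      then have "|{a} \<union> N f a| \<le>o |K a|"
        by (rule card_of_Un_ordLeq_infinite[OF Kinf, rotated]) (simp add: countable_ordLeq_infinite Kinf)
      then have "|insert a (N f a)| \<le>o |K a|" by simp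
      moreover have "insert a (N f a) \<subseteq> E" using True f unfolding N_def by blast
      ultimately have "\<exists>M. insert a (N f a) \<subseteq> M \<and> M \<subseteq> E \<and> |M| \<le>o |K a| \<and>
          faithful en (M - N f a) (E - N f a) \<and>
          (\<forall>x\<in>\<Union> (en ` M). \<forall>y\<in>\<Union> (en ` M). W (insert a (L a)) x y \<subseteq> M)"
        by (intro faithful_extension_exists[where W="W (insert a (L a))"] fin Kinf W)
      then show ?thesis unfolding Q_def by blast
    qed (simp add: Q_def)
  qed
  then obtain f where f: "\<And>a. Q f a (f a)" by blast
  have fN: "insert a (N f a) \<subseteq> f a" and fE: "f a \<subseteq> E" and fK: "|f a| \<le>o |K a|"
    and ff: "faithful en (f a - N f a) (E - N f a)"
    and fW: "\<And>x y. x \<in> \<Union> (en ` f a) \<Longrightarrow> y \<in> \<Union> (en ` f a) \<Longrightarrow> W (insert a (L a)) x y \<subseteq> f a"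
    if "a \<in> E" for a
    using f[of a] that unfolding Q_def by blast+
  have fmono: "f b \<subseteq> f m" if "b \<in> insert m (L m)" "m \<in> E" for b m
    using that fN[OF that(2)] unfolding N_def by blast
  define D where "D a = f a - N f a" for a
  have NE: "N f a \<subseteq> E" for a unfolding N_def using fE LE(1) by blast
  have faith: "faithful en (E - N f a) E" if a: "a \<in> E" for a
  proof (rule faithful_Diff_min_cut[OF NE])
    show inf: "infinite (Z \<union> L a)" using Z(3) by simp
    have "|f b| \<le>o |Z \<union> L a|" if b: "b \<in> L a" for b
    proof -
      have "K b \<subseteq> Z \<union> L a" unfolding K_def using b Ltrans by blast
      then have "|K b| \<le>o |Z \<union> L a|" by (rule card_of_mono1)
      with fK[OF LE(1)[OF b]] show ?thesis by (rule ordLeq_transitive)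
    qed
    moreover have "|L a| \<le>o |Z \<union> L a|" by (rule card_of_mono1) blast
    ultimately show "|N f a| \<le>o |Z \<union> L a|"
      unfolding N_def by (intro card_of_UNION_ordLeq_infinite inf) auto
    fix x y
    assume x: "x \<in> \<Union> (en ` N f a)" and y: "y \<in> \<Union> (en ` N f a)" and ne: "x \<noteq> y"
    have "C x y \<subseteq> N f a \<or> |Z \<union> L a| <o |C x y|"
    \<comment> \<open>Either every edge of the cut was due before stage \<open>a\<close>, or some
      index lies at or beyond \<open>a\<close>.\<close>
    proof (cases "countable (C x y) \<or> g x y ` C x y \<subseteq> L a")
      case True
      obtain b1 b2 where b1: "b1 \<in> L a" "x \<in> \<Union> (en ` f b1)" and b2: "b2 \<in> L a" "y \<in> \<Union> (en ` f b2)"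
        using x y unfolding N_def by blast
      obtain b where b: "b \<in> L a" "b1 \<in> insert b (L b)" "b2 \<in> insert b (L b)"
        using Lmax[OF b1(1) b2(1)] by blast
      have bE: "b \<in> E" using LE(1)[OF b(1)] .
      have bxy: "x \<in> \<Union> (en ` f b)" "y \<in> \<Union> (en ` f b)"
        using b1(2) b2(2) fmono[OF b(2) bE] fmono[OF b(3) bE] by blast+
      \<comment> \<open>A stage \<open>m\<close> before \<open>a\<close> that touches
        \<open>x\<close> and \<open>y\<close> and has reached the index of \<open>c\<close> absorbs
        \<open>c\<close>.\<close>
      have "c \<in> N f a" if c: "c \<in> C x y" for c
      proof -
        obtain m where m: "m \<in> L a" "b \<in> insert m (L m)" and gm: "countable (C x y) \<or> g x y c \<in> insert m (L m)"
        proof (cases "countable (C x y)")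
          case True
          then show ?thesis using that b(1) by blast
        next
          case False
          then have "g x y c \<in> L a" using True c by blast
          then show ?thesis using that Lmax[OF b(1)] by blast
        qed
        have mE: "m \<in> E" using LE(1)[OF m(1)] .
        have "W (insert m (L m)) x y \<subseteq> f m"
          using bxy fmono[OF m(2) mE] by (intro fW mE) blast+
        moreover have "c \<in> W (insert m (L m)) x y" using c gm ne by (simp add: W_def)
        ultimately show ?thesis using m(1) unfolding N_def by blast
      qed
      then show ?thesis by blast
    next
      case False
      then obtain c where c: "c \<in> C x y" "g x y c \<notin> L a" by blast
      have gc: "g x y c \<in> E" "|L (g x y c)| <o |C x y|" using g[OF ne] c by blast+
      \<comment> \<open>An index at or beyond \<open>a\<close> is used only by cuts with more than
        \<open>|L a|\<close> edges.\<close>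
      have "L a \<subseteq> L (g x y c)" using Llin[OF gc(1) a] c(2) Ltrans by blast
      then have "|L a| \<le>o |L (g x y c)|" by (rule card_of_mono1)
      then have "|L a| <o |C x y|" using gc(2) by (rule ordLeq_ordLess_trans)
      moreover have "|Z| <o |C x y|" using Z(2) False by (intro countable_ordLess_uncountable) auto
      moreover have "infinite (C x y)" using False countable_finite by blast
      ultimately show ?thesis using card_of_Un_ordLess_infinite by blast
    qed
    then show "min_cut en E x y \<subseteq> N f a \<or> |Z \<union> L a| <o |min_cut en E x y|" unfolding C_def .
  qed
  have "faithful en (D a) E" if "a \<in> E" for a
    unfolding D_def by (rule faithful_trans[OF ff[OF that] faith[OF that]])
  moreover have "|D a| <o |E|" if a: "a \<in> E" for a
  proof -
    have "|L a| <o |E|" unfolding L_def using a by (intro card_of_underS card_of_Card_order) (simp add: Field_card_of)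
    moreover have "|insert a Z| <o |E|" using Z(2) unc by (intro countable_ordLess_uncountable) auto
    ultimately have "|insert a Z \<union> L a| <o |E|" by (intro card_of_Un_ordLess_infinite infE)
    moreover have "insert a Z \<union> L a = K a" by (auto simp: K_def)
    ultimately have "|K a| <o |E|" by simp
    with fK[OF a] have "|f a| <o |E|" by (rule ordLeq_ordLess_trans)
    moreover have "|D a| \<le>o |f a|" unfolding D_def by (rule card_of_mono1) blast
    ultimately show ?thesis using ordLeq_ordLess_trans by blast
  qed
  moreover have disj: "D a \<inter> D b = {}" if "a \<in> L b" for a b
    using that unfolding D_def N_def by blast
  have "D a \<inter> D b = {}" if "a \<in> E" "b \<in> E" "a \<noteq> b" for a b
    using Llin[OF that(1,2)] that(3) disj[of a b] disj[of b a] by blast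
  moreover have "(\<Union>a\<in>E. D a) = E"
  proof
    show "(\<Union>a\<in>E. D a) \<subseteq> E" using fE unfolding D_def by blast
    show "E \<subseteq> (\<Union>a\<in>E. D a)"
    proof
      fix e assume e: "e \<in> E"
      \<comment> \<open>Stage \<open>e\<close> contains \<open>e\<close>; the first stage that does
        so has \<open>e\<close> in its difference.\<close>
      then have "e \<in> {a \<in> E. e \<in> f a}" using fN by blast
      from wfE_min[OF underS_card_of(1) this] obtain a
        where a: "a \<in> {a \<in> E. e \<in> f a}" "\<And>b. (b, a) \<in> |E| - Id \<Longrightarrow> b \<notin> {a \<in> E. e \<in> f a}"
        by metis
      have "e \<notin> N f a"
      proof
        assume "e \<in> N f a"
        then obtain b where b: "b \<in> L a" "e \<in> f b" unfolding N_def by blast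
        then have "(b, a) \<in> |E| - Id" by (auto simp: L_def underS_def)
        then show False using a(2) b LE(1) by blast
      qed
      then show "e \<in> (\<Union>a\<in>E. D a)" using a(1) unfolding D_def by blast
    qed
  qed
  ultimately show ?thesis by (intro exI[of _ D]) simp
qed

text \<open>Induction on the cardinal \<open>|E|\<close>: each difference has fewer edges and is
  decomposed in turn, and faithfulness is transitive.\<close>

theorem countable_faithful_partition:
  fixes en :: "'e \<Rightarrow> 'v set"
  assumes "\<And>e. e \<in> E \<Longrightarrow> finite (en e)"
  shows "\<exists>P. \<Union>P = E \<and> pairwise disjnt P \<and> (\<forall>A\<in>P. countable A \<and> faithful en A E)"
  using assms
proof (induction E rule: wf_induct_rule[OF wf_inv_image[OF wf_ordLess, of card_of]])
  case (1 E)
  show ?case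
  proof (cases "countable E")
    case True
    then show ?thesis by (intro exI[of _ "{E}"]) (simp add: faithful_refl pairwise_def)
  next
    case False
    from small_faithful_partition[of E en, OF 1(2) this]
    obtain D where D: "(\<Union>a\<in>E. D a) = E" "\<And>a b. a \<in> E \<Longrightarrow> b \<in> E \<Longrightarrow> a \<noteq> b \<Longrightarrow> D a \<inter> D b = {}"
      "\<And>a. a \<in> E \<Longrightarrow> |D a| <o |E|" "\<And>a. a \<in> E \<Longrightarrow> faithful en (D a) E" by auto
    have "\<exists>P. \<Union>P = D a \<and> pairwise disjnt P \<and> (\<forall>A\<in>P. countable A \<and> faithful en A (D a))"
      if a: "a \<in> E" for a
    proof (rule 1(1))
      show "(D a, E) \<in> inv_image ordLess card_of" using D(3)[OF a] by simp
      show "finite (en e)" if "e \<in> D a" for e using D(1) a that by (intro 1(2)) blast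
    qed
    then obtain P where P: "\<And>a. a \<in> E \<Longrightarrow> \<Union> (P a) = D a" "\<And>a. a \<in> E \<Longrightarrow> pairwise disjnt (P a)"
      "\<And>a A. a \<in> E \<Longrightarrow> A \<in> P a \<Longrightarrow> countable A" "\<And>a A. a \<in> E \<Longrightarrow> A \<in> P a \<Longrightarrow> faithful en A (D a)"
      by metis
    have "\<Union> (\<Union> (P ` E)) = (\<Union>a\<in>E. \<Union> (P a))" by blast
    also have "\<dots> = E" using P(1) D(1) by simp
    finally have "\<Union> (\<Union> (P ` E)) = E" .
    moreover have "pairwise disjnt (\<Union> (P ` E))"
    proof (rule pairwiseI)
      fix A B assume "A \<in> \<Union> (P ` E)" "B \<in> \<Union> (P ` E)" and ne: "A \<noteq> B"
      then obtain a b where ab: "a \<in> E" "b \<in> E" "A \<in> P a" "B \<in> P b" by blast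
      show "disjnt A B"
      proof (cases "a = b")
        case True
        then show ?thesis using ab ne P(2)[of a] by (auto simp: pairwise_def)
      next
        case False
        then have "D a \<inter> D b = {}" using D(2) ab by blast
        moreover have "A \<subseteq> D a" "B \<subseteq> D b" using P(1) ab by blast+
        ultimately show ?thesis unfolding disjnt_def by blast
      qed
    qed
    moreover have "countable A \<and> faithful en A E" if "A \<in> \<Union> (P ` E)" for A
      using that P(3,4) D(4) faithful_trans by blast
    ultimately show ?thesis by blast
  qed
qed

section \<open>Combining orientations of the pieces\<close>

text \<open>Local edge-connectivity at least \<open>k\<close>. Infinite connectivity appears as
  \<open>linked\<close> for every \<open>k\<close>.\<close>

definition linked :: "('e \<Rightarrow> 'v set) \<Rightarrow> 'e set \<Rightarrow> nat \<Rightarrow> 'v \<Rightarrow> 'v \<Rightarrow> bool" where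
  "linked en E k u v \<longleftrightarrow> (\<forall>F. finite F \<longrightarrow> F \<subseteq> E \<longrightarrow> card F < k \<longrightarrow> conn en (E - F) u v)"

definition out_cut :: "('e \<Rightarrow> 'v set) \<Rightarrow> 'e set \<Rightarrow> ('e \<Rightarrow> 'v) \<Rightarrow> 'v set \<Rightarrow> 'e set" where
  "out_cut en E t X = {e \<in> E \<inter> cut_edges en X. t e \<in> X}"

text \<open>Well-balancedness in terms of cuts, with \<open>t\<close> giving the tails. Infinite
  out-cuts satisfy the bound automatically, so uncountable connectivities need a separate
  count.\<close>

definition balanced :: "('e \<Rightarrow> 'v set) \<Rightarrow> 'e set \<Rightarrow> ('e \<Rightarrow> 'v) \<Rightarrow> bool" where
  "balanced en E t \<longleftrightarrow> (\<forall>X u v k. u \<in> X \<longrightarrow> v \<notin> X \<longrightarrow> linked en E k u v \<longrightarrow>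
     finite (out_cut en E t X) \<longrightarrow> k div 2 \<le> card (out_cut en E t X))"

lemma linkedD: "linked en E k u v \<Longrightarrow> finite F \<Longrightarrow> F \<subseteq> E \<Longrightarrow> card F < k \<Longrightarrow> conn en (E - F) u v"
  by (simp add: linked_def)

lemma balancedD:
  "balanced en E t \<Longrightarrow> u \<in> X \<Longrightarrow> v \<notin> X \<Longrightarrow> linked en E k u v \<Longrightarrow> finite (out_cut en E t X)
     \<Longrightarrow> k div 2 \<le> card (out_cut en E t X)"
  by (simp add: balanced_def)

lemma linked_trans_sym:
  assumes "linked en E k u v" "linked en E k u w"
  shows "linked en E k v w"
  unfolding linked_def
proof (intro allI impI)
  fix F assume "finite F" "F \<subseteq> E" "card F < k"
  then have "conn en (E - F) u v" "conn en (E - F) u w" using assms by (simp_all add: linked_def)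
  then show "conn en (E - F) v w" by (rule conn_trans[OF conn_sym])
qed

lemma linked_faithful:
  assumes "faithful en A E" "conn en A x y" "linked en E k x y"
  shows "linked en A k x y"
  unfolding linked_def
proof (intro allI impI)
  fix F assume F: "finite F" "F \<subseteq> A" "card F < k"
  then have "conn en (E - F) x y"
    using assms(3) faithful_subset[OF assms(1)] by (simp add: linked_def)
  then show "conn en (A - F) x y" by (rule faithfulD[OF assms(1,2) F(1,2)])
qed

section \<open>Finite connectivity: chains of linked pairs\<close>

lemma rtrancl_crosses:
  assumes "(u, v) \<in> R\<^sup>*" "u \<in> X" "v \<notin> X"
  shows "\<exists>x y. (x, y) \<in> R \<and> x \<in> X \<and> y \<notin> X"
  using assms by (induction rule: rtrancl_induct) auto

text \<open>Take the first step into \<open>Y\<close>. The bound \<open>i < m\<close> is what makes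
  the rerouted chain in \<open>linked_chain\<close> shorter than the given one.\<close>

lemma relpow_crosses:
  assumes "(w, v) \<in> S ^^ m" "w \<notin> Y" "v \<in> Y"
  shows "\<exists>a b i. (a, b) \<in> S \<and> a \<notin> Y \<and> b \<in> Y \<and> (b, v) \<in> S ^^ i \<and> i < m"
  using assms
proof (induction m arbitrary: w)
  case (Suc m)
  obtain z where z: "(w, z) \<in> S" "(z, v) \<in> S ^^ m" using relpow_Suc_D2[OF Suc.prems(1)] by blast
  show ?case
  proof (cases "z \<in> Y")
    case True
    then show ?thesis using z Suc.prems(2) by blast
  next
    case False
    from Suc.IH[OF z(2) this Suc.prems(3)] show ?thesis by (meson less_SucI)
  qed
qed simp

text \<open>Edges of \<open>F\<close> outside the component of \<open>u\<close> are irrelevant: if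
  \<open>X\<close> separates in \<open>A - F\<close>, its intersection with that component does so
  too, and is met only by edges touching the component.\<close>

lemma conn_Diff_component:
  assumes "conn en (A - {e \<in> F. \<exists>a\<in>en e. conn en A u a}) u w"
  shows "conn en (A - F) u w"
proof (rule ccontr)
  let ?F = "{e \<in> F. \<exists>a\<in>en e. conn en A u a}"
  assume "\<not> conn en (A - F) u w"
  then obtain X where X: "(A - F) \<inter> cut_edges en X = {}" "u \<in> X" "w \<notin> X" by (rule not_connE)
  have "u \<in> X \<inter> component en A u" "w \<notin> X \<inter> component en A u"
    using X(2,3) by (simp_all add: component_def)
  then obtain e where e: "e \<in> A - ?F" "e \<in> cut_edges en (X \<inter> component en A u)"
    using conn_crosses[OF assms] by blast
  from e(2) obtain a b where ab: "a \<in> en e" "b \<in> en e" "a \<in> X \<inter> component en A u" "b \<notin> X \<inter> component en A u"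
    by (rule cut_edgesE)
  have ua: "conn en A u a" using ab(3) by (simp add: component_def)
  moreover have "conn en A a b" using e(1) ab(1,2) by (intro conn_edge[of e]) auto
  ultimately have "conn en A u b" by (rule conn_trans)
  then have "b \<notin> X" using ab(4) by (simp add: component_def)
  moreover have "a \<in> X" using ab(3) by blast
  ultimately have "e \<in> cut_edges en X" using cut_edgesI[of a en e b] ab(1,2) by blast
  then have "e \<in> F" using X(1) e(1) by blast
  then show False using e(1) ab(1) ua by blast
qed

text \<open>If a chain of pieces leaves the class of \<open>u\<close>, then a small cut separates its second vertex
  from \<open>u\<close> and from \<open>v\<close>. By faithfulness this cut lies in one component of the first piece, so the
  chain returns through that component and can be shortened.\<close>

lemma linked_chain:
  assumes P: "pairwise disjnt P" "\<And>A. A \<in> P \<Longrightarrow> faithful en A E"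
    and uv: "(u, v) \<in> {(x, y). \<exists>A\<in>P. conn en A x y} ^^ n" "linked en E k u v"
  shows "(u, v) \<in> {(x, y). \<exists>A\<in>P. conn en A x y \<and> linked en E k x y}\<^sup>*"
  using uv
proof (induction n arbitrary: u rule: less_induct)
  case (less n)
  let ?S = "{(x, y). \<exists>A\<in>P. conn en A x y}"
  let ?R = "{(x, y). \<exists>A\<in>P. conn en A x y \<and> linked en E k x y}"
  show ?case
  proof (cases n)
    case 0
    then show ?thesis using less.prems(1) by simp
  next
    case (Suc m)
    then obtain w where w: "(u, w) \<in> ?S" "(w, v) \<in> ?S ^^ m"
      using less.prems(1) relpow_Suc_D2[of u v m ?S] by blast
    from w(1) obtain A where A: "A \<in> P" "conn en A u w" by auto
    note fA = P(2)[OF A(1)]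
    show ?thesis
    proof (cases "linked en E k u w")
      case True
      then have "(u, w) \<in> ?R" using A by blast
      moreover have "linked en E k w v" by (rule linked_trans_sym[OF True less.prems(2)])
      then have "(w, v) \<in> ?R\<^sup>*" using w(2) Suc by (intro less.IH[of m]) auto
      ultimately show ?thesis by (rule converse_rtrancl_into_rtrancl)
    next
      case False
      then obtain F where F: "finite F" "F \<subseteq> E" "card F < k" "\<not> conn en (E - F) u w"
        by (auto simp: linked_def)
      define F' where "F' = {e \<in> F \<inter> A. \<exists>a\<in>en e. conn en A u a}"
      have F'A: "F' \<subseteq> A" "finite F'" using F(1) by (auto simp: F'_def)
      have "\<not> conn en (A - F') u w"
      proof
        assume "conn en (A - F') u w"
        then have "conn en (A - F \<inter> A) u w" unfolding F'_def by (rule conn_Diff_component)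
        then have "conn en (E - F) u w"
          by (rule conn_mono) (use faithful_subset[OF fA] in blast)
        then show False using F(4) by contradiction
      qed
      then have nw: "\<not> conn en (E - F') u w" using faithfulD[OF fA A(2) F'A(2,1)] by blast
      have "card F' \<le> card F" by (rule card_mono[OF F(1)]) (auto simp: F'_def)
      then have cv: "conn en (E - F') u v"
        using F'A faithful_subset[OF fA] F(3) by (intro linkedD[OF less.prems(2)]) auto
      let ?Y = "component en (E - F') u"
      have Y: "w \<notin> ?Y" "v \<in> ?Y" using nw cv by (simp_all add: component_def)
      from relpow_crosses[OF w(2) Y] obtain a b i
        where ab: "(a, b) \<in> ?S" "a \<notin> ?Y" "b \<in> ?Y" "(b, v) \<in> ?S ^^ i" "i < m" by blast
      from ab(1) obtain A' where A': "A' \<in> P" "conn en A' a b" by auto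
      \<comment> \<open>Intersecting with the component of \<open>b\<close> ensures that the edge of
        \<open>A'\<close> found crossing \<open>?Y\<close> is still joined to \<open>b\<close>
        within \<open>A'\<close>.\<close>
      have "b \<in> ?Y \<inter> component en A' b" "a \<notin> ?Y \<inter> component en A' b"
        using ab(2,3) by (simp_all add: component_def)
      then obtain f where f: "f \<in> A'" "f \<in> cut_edges en (?Y \<inter> component en A' b)"
        using conn_crosses[OF conn_sym[OF A'(2)]] by blast
      from f(2) obtain c d where cd: "c \<in> en f" "d \<in> en f"
          "c \<in> ?Y \<inter> component en A' b" "d \<notin> ?Y \<inter> component en A' b" by (rule cut_edgesE)
      have bc: "conn en A' b c" using cd(3) by (simp add: component_def)
      have "conn en A' b d" by (rule conn_trans[OF bc conn_edge[where en=en and e=f, OF f(1) cd(1,2)]])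
      then have "d \<notin> ?Y" using cd(4) by (simp add: component_def)
      then have "f \<in> cut_edges en ?Y" using cut_edgesI[where en=en and e=f, OF cd(1,2)] cd(3) by blast
      moreover have "f \<in> E" using f(1) faithful_subset[OF P(2)[OF A'(1)]] by blast
      ultimately have "f \<in> F'" using component_closed[of "E - F'" en u] by blast
      then obtain a' where a': "f \<in> A" "a' \<in> en f" "conn en A u a'" unfolding F'_def by blast
      \<comment> \<open>\<open>f\<close> lies in both pieces, and distinct pieces are
        disjoint.\<close>
      have "A = A'" using P(1) A(1) A'(1) f(1) a'(1) unfolding pairwise_def disjnt_def by blast
      then have "conn en A u b"
        using conn_trans[OF conn_trans[OF a'(3) conn_edge[where en=en and e=f, OF a'(1,2) cd(1)]] conn_sym] bc by blast
      then have "(u, b) \<in> ?S" using A(1) by blast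
      \<comment> \<open>One step inside \<open>A\<close> to \<open>b\<close> and then
        \<open>i\<close> steps: at most \<open>m\<close>, hence fewer than \<open>n\<close>.\<close>
      then have "(u, v) \<in> ?S ^^ Suc i" using ab(4) by (rule relpow_Suc_I2)
      then show ?thesis using ab(5) Suc less.prems(2) by (intro less.IH[of "Suc i"]) auto
    qed
  qed
qed

lemma linked_crosses_piece:
  assumes P: "\<Union>P = E" "pairwise disjnt P" "\<And>A. A \<in> P \<Longrightarrow> faithful en A E"
    and uv: "u \<in> X" "v \<notin> X" "linked en E k u v" "k > 0"
  shows "\<exists>A\<in>P. \<exists>x\<in>X. \<exists>y. y \<notin> X \<and> linked en A k x y"
proof -
  let ?S = "{(x, y). \<exists>A\<in>P. conn en A x y}"
  have "conn en (E - {}) u v" by (rule linkedD[OF uv(3)]) (use uv(4) in auto)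
  then have c: "conn en E u v" by simp
  \<comment> \<open>\<open>Z\<close> is what chains through pieces reach from \<open>u\<close>; as
    the pieces cover \<open>E\<close>, no edge leaves it.\<close>
  define Z where "Z = {z. (u, z) \<in> ?S\<^sup>*}"
  have "v \<in> Z"
  proof (rule ccontr)
    assume vZ: "v \<notin> Z"
    have uZ: "u \<in> Z" by (simp add: Z_def)
    obtain e where e: "e \<in> E" "e \<in> cut_edges en Z" using conn_crosses[OF c uZ vZ] by blast
    from e(2) obtain a b where ab: "a \<in> en e" "b \<in> en e" "a \<in> Z" "b \<notin> Z" by (rule cut_edgesE)
    obtain A where A: "A \<in> P" "e \<in> A" using e(1) P(1) by blast
    have "conn en A a b" by (rule conn_edge[where en=en and e=e, OF A(2) ab(1,2)])
    then have "(a, b) \<in> ?S" using A(1) by blast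
    moreover have "(u, a) \<in> ?S\<^sup>*" using ab(3) unfolding Z_def by simp
    ultimately have "(u, b) \<in> ?S\<^sup>*" by (rule rtrancl.rtrancl_into_rtrancl[rotated])
    then have "b \<in> Z" by (simp add: Z_def)
    then show False using ab(4) by contradiction
  qed
  then have "(u, v) \<in> ?S\<^sup>*" by (simp add: Z_def)
  then obtain n where "(u, v) \<in> ?S ^^ n" using rtrancl_power[of "(u, v)" ?S] by auto
  from linked_chain[OF P(2,3) this uv(3)] rtrancl_crosses[OF _ uv(1,2)]
  obtain x y A where "A \<in> P" "conn en A x y" "linked en E k x y" "x \<in> X" "y \<notin> X" by blast
  then show ?thesis using linked_faithful[OF P(3)] by blast
qed

section \<open>Uncountable connectivity: non-bridges in a cut\<close>

text \<open>Without \<open>b\<close>, the set \<open>P\<close> still joins \<open>u\<close> to one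
  end of \<open>b\<close> and \<open>v\<close> to the other. A connection of \<open>u\<close> and
  \<open>v\<close> in \<open>E - {b}\<close> would thus connect the ends of the bridge
  \<open>b\<close>.\<close>

lemma not_conn_bridge:
  assumes P: "conn en P u v" "\<not> conn en (P - {b}) u v" "P \<subseteq> E"
    and b: "c \<in> en b" "d \<in> en b" "\<not> conn en (E - {b}) c d" "card (en b) = 2"
  shows "\<not> conn en (E - {b}) u v"
proof
  assume uv: "conn en (E - {b}) u v"
  have cross: "\<exists>c'\<in>en b. \<exists>d'\<in>en b. conn en (P - {b}) x c' \<and> \<not> conn en (P - {b}) x d'"
    if xy: "conn en P x y" "\<not> conn en (P - {b}) x y" for x y
  proof -
    let ?Y = "component en (P - {b}) x"
    have "x \<in> ?Y" "y \<notin> ?Y" using xy(2) by (simp_all add: component_def)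
    then obtain e where e: "e \<in> P" "e \<in> cut_edges en ?Y" using conn_crosses[OF xy(1)] by blast
    have "e = b" using e component_closed[of "P - {b}" en x] by blast
    then show ?thesis using e(2) by (auto simp: component_def cut_edges_def)
  qed
  obtain c1 where c1: "c1 \<in> en b" "conn en (P - {b}) u c1" using cross[OF P(1,2)] by blast
  obtain d1 where d1: "d1 \<in> en b" "conn en (P - {b}) v d1"
    using cross[OF conn_sym[OF P(1)]] P(2) conn_sym[of en "P - {b}" v u] by blast
  have "c1 \<noteq> d1" using c1(2) conn_sym[OF d1(2)] P(2) conn_trans by metis
  moreover have "c \<noteq> d" using b(3) by auto
  ultimately have "c1 = c \<and> d1 = d \<or> c1 = d \<and> d1 = c"
    using b(1,2,4) c1(1) d1(1) by (auto simp: card_2_iff)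
  moreover have sub: "P - {b} \<subseteq> E - {b}" using P(3) by blast
  have "conn en (E - {b}) c1 d1"
    by (rule conn_trans[OF conn_sym[OF conn_mono[OF c1(2) sub]] conn_trans[OF uv conn_mono[OF d1(2) sub]]])
  ultimately show False using b(3) conn_sym[of en "E - {b}" c1 d1] by auto
qed

text \<open>A minimal connecting set avoiding the non-bridges of the cut would cross
  \<open>X\<close> in a bridge \<open>b\<close>. By minimality it needs \<open>b\<close>, so
  \<open>b\<close> alone would separate \<open>u\<close> from \<open>v\<close> in
  \<open>E\<close>.\<close>

lemma bridgeless_cut_separates:
  assumes en: "\<And>e. e \<in> E \<Longrightarrow> card (en e) = 2"
    and uv: "u \<in> X" "v \<notin> X" "\<And>e. conn en (E - {e}) u v"
  shows "\<not> conn en (E - {e \<in> E \<inter> cut_edges en X. \<forall>a\<in>en e. \<forall>b\<in>en e. conn en (E - {e}) a b}) u v"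
    (is "\<not> conn en (E - ?F) u v")
proof
  assume "conn en (E - ?F) u v"
  then have "\<exists>P. finite P \<and> P \<subseteq> E - ?F \<and> conn en P u v" by (rule conn_finite)
  then obtain P where P: "finite P \<and> P \<subseteq> E - ?F \<and> conn en P u v"
    and min: "\<And>P'. finite P' \<and> P' \<subseteq> E - ?F \<and> conn en P' u v \<Longrightarrow> card P \<le> card P'"
    using exists_least_iff[of "\<lambda>n. \<exists>P. (finite P \<and> P \<subseteq> E - ?F \<and> conn en P u v) \<and> card P = n"]
    by (metis (no_types, lifting) not_le)
  obtain b where b: "b \<in> P" "b \<in> cut_edges en X" using conn_crosses[OF _ uv(1,2), of en P] P by blast
  have bE: "b \<in> E" using P b(1) by blast
  obtain c d where cd: "c \<in> en b" "d \<in> en b" "\<not> conn en (E - {b}) c d"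
  proof -
    have "b \<notin> ?F" using P b(1) by blast
    then show ?thesis using that b(2) bE by blast
  qed
  have "\<not> conn en (P - {b}) u v"
  proof
    assume "conn en (P - {b}) u v"
    then have "card P \<le> card (P - {b})" using P by (intro min) blast
    then show False using P b(1) by (metis card_Diff1_less not_le)
  qed
  moreover have "P \<subseteq> E" using P by blast
  ultimately have "\<not> conn en (E - {b}) u v"
    using P by (intro not_conn_bridge[of en P u v b E c d] cd en bE) auto
  then show False using uv(3) by contradiction
qed

lemma uncountable_out_cut:
  fixes en :: "'e \<Rightarrow> 'v set" and K :: "'k set"
  assumes en: "\<And>e. e \<in> E \<Longrightarrow> card (en e) = 2"
    and P: "\<Union>P = E" "pairwise disjnt P" "\<And>A. A \<in> P \<Longrightarrow> faithful en A E"
    and cnt: "\<And>A. A \<in> P \<Longrightarrow> countable A" and bal: "\<And>A. A \<in> P \<Longrightarrow> balanced en A t"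
    and uv: "u \<in> X" "v \<notin> X" and K: "uncountable K"
    and sep: "\<And>F. F \<subseteq> E \<Longrightarrow> \<not> conn en (E - F) u v \<Longrightarrow> |K| \<le>o |F|"
  shows "|K| \<le>o |out_cut en E t X|"
proof -
  let ?F = "{e \<in> E \<inter> cut_edges en X. \<forall>a\<in>en e. \<forall>b\<in>en e. conn en (E - {e}) a b}"
  have uncF: "\<not> countable F" if "|K| \<le>o |F|" for F :: "'e set" using that K countable_ordLeq by blast
  have "conn en (E - {e}) u v" for e
  proof (rule ccontr)
    assume n: "\<not> conn en (E - {e}) u v"
    have "E - E \<inter> {e} = E - {e}" by blast
    then have "|K| \<le>o |E \<inter> {e}|" using n by (intro sep) auto
    then show False using uncF by auto
  qed
  from bridgeless_cut_separates[OF en uv this]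
  have KF: "|K| \<le>o |?F|" by (intro sep) auto
  define Q where "Q = {A \<in> P. A \<inter> ?F \<noteq> {}}"
  have "\<exists>e. e \<in> out_cut en A t X" if A: "A \<in> Q" for A
  proof -
    have AP: "A \<in> P" using A by (simp add: Q_def)
    obtain e where e: "e \<in> A" "e \<in> ?F" using A unfolding Q_def by blast
    obtain a b where ab: "a \<in> en e" "b \<in> en e" "a \<in> X" "b \<notin> X"
      using e(2) by (auto elim: cut_edgesE)
    have cab: "conn en A a b" by (rule conn_edge[where en=en and e=e, OF e(1) ab(1,2)])
    \<comment> \<open>As \<open>e\<close> joins \<open>a\<close> and \<open>b\<close>, only
      \<open>F = {e}\<close> is critical; \<open>e\<close> is no bridge of \<open>E\<close>, and
      faithfulness carries this to \<open>A\<close>. The value 2 gives at least one outgoing edge,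
      since \<open>2 div 2 = 1\<close>.\<close>
    have "linked en A 2 a b"
      unfolding linked_def
    proof (intro allI impI)
      fix F assume F: "finite F" "F \<subseteq> A" "card F < 2"
      show "conn en (A - F) a b"
      proof (cases "e \<in> F")
        case True
        have Fe: "F = {e}" using True F(3) card_le_Suc0_iff_eq[OF F(1)] by auto
        have "conn en (E - F) a b" using e(2) ab(1,2) unfolding Fe by blast
        then show ?thesis by (rule faithfulD[OF P(3)[OF AP] cab F(1,2)])
      next
        case False
        then show ?thesis using e(1) ab(1,2) by (intro conn_edge[of e]) auto
      qed
    qed
    from balancedD[OF bal[OF AP] ab(3,4) this]
    show ?thesis by (cases "out_cut en A t X = {}") auto
  qed
  then obtain g where g: "\<And>A. A \<in> Q \<Longrightarrow> g A \<in> out_cut en A t X" by metis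
  have gA: "g A \<in> A" "g A \<in> out_cut en E t X" if "A \<in> Q" for A
    using g[OF that] that P(1) unfolding out_cut_def Q_def by blast+
  have "inj_on g Q"
  proof (rule inj_onI)
    fix A B assume AB: "A \<in> Q" "B \<in> Q" "g A = g B"
    then have "\<not> disjnt A B" using gA(1)[OF AB(1)] gA(1)[OF AB(2)] by (auto simp: disjnt_def)
    then show "A = B" using P(2) AB(1,2) unfolding Q_def pairwise_def by blast
  qed
  then have Qout: "|Q| \<le>o |out_cut en E t X|" using gA(2) card_of_ordLeq[of Q] by blast
  have FQ: "?F \<subseteq> (\<Union>A\<in>Q. A)" using P(1) unfolding Q_def by blast
  have cQ: "countable A" if "A \<in> Q" for A using that cnt by (simp add: Q_def)
  \<comment> \<open>The countable pieces in \<open>Q\<close> cover \<open>?F\<close>, and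
    \<open>Q\<close> injects into the out-cut. A finite out-cut would make \<open>?F\<close>
    countable; an infinite one bounds \<open>|?F|\<close>.\<close>
  show ?thesis
  proof (cases "finite (out_cut en E t X)")
    case True
    then have "finite Q" using Qout card_of_ordLeq_finite by blast
    then have "countable (\<Union>A\<in>Q. A)" using cQ by (rule countable_UN[OF countable_finite])
    then have "countable ?F" using FQ countable_subset by blast
    then show ?thesis using uncF[OF KF] by blast
  next
    case False
    have "|\<Union>A\<in>Q. A| \<le>o |out_cut en E t X|"
      using False Qout by (rule card_of_UNION_ordLeq_infinite) (use cQ False countable_ordLeq_infinite in blast)
    then show ?thesis using KF card_of_mono1[OF FQ] ordLeq_transitive by blast
  qed
qed

lemma balanced_Union:
  assumes P: "\<Union>P = E" "pairwise disjnt P" "\<And>A. A \<in> P \<Longrightarrow> faithful en A E"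
    and bal: "\<And>A. A \<in> P \<Longrightarrow> balanced en A t"
  shows "balanced en E t"
  unfolding balanced_def
proof (intro allI impI)
  fix X u v k
  assume uv: "u \<in> X" "v \<notin> X" "linked en E k u v" and fin: "finite (out_cut en E t X)"
  show "k div 2 \<le> card (out_cut en E t X)"
  proof (cases "k = 0")
    case False
    then obtain A x y where A: "A \<in> P" "x \<in> X" "y \<notin> X" "linked en A k x y"
      using linked_crosses_piece[OF P uv] by blast
    have sub: "out_cut en A t X \<subseteq> out_cut en E t X" using A(1) P(1) by (auto simp: out_cut_def)
    have "k div 2 \<le> card (out_cut en A t X)"
      using bal[OF A(1)] A(2-4) finite_subset[OF sub fin] by (rule balancedD)
    also have "\<dots> \<le> card (out_cut en E t X)" by (rule card_mono[OF fin sub])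
    finally show ?thesis .
  qed simp
qed

section \<open>Countable graphs\<close>

lemma ex_change:
  fixes P :: "nat \<Rightarrow> bool"
  assumes "i \<le> n" "P i \<noteq> P n"
  shows "\<exists>j\<ge>i. j < n \<and> P j \<noteq> P (Suc j)"
  using assms
proof (induction n rule: dec_induct)
  case (step n)
  then show ?case by (cases "P i = P n") (auto intro: less_SucI)
qed simp

text \<open>Every vertex \<open>w\<close> is replaced by a ray \<open>(w, 0), (w, 1), \<dots>\<close> with \<open>j + 1\<close> parallel edges
  between \<open>(w, j)\<close> and \<open>(w, j + 1)\<close>, and the edge with number \<open>n\<close> is attached at height \<open>n\<close>. An
  edge of the original graph that crosses a cut only after the ends of the rays are moved to one
  side is charged to a ray edge of its own.\<close>

lemma countable_balanced:
  fixes en :: "'e \<Rightarrow> 'v set"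
  assumes lf: "\<And>(E' :: ('e + 'v \<times> nat \<times> nat) set) (en' :: _ \<Rightarrow> ('v \<times> nat) set).
      countable E' \<Longrightarrow> (\<And>e. e \<in> E' \<Longrightarrow> card (en' e) = 2) \<Longrightarrow> (\<And>x. finite {e \<in> E'. x \<in> en' e})
      \<Longrightarrow> \<exists>t. (\<forall>e\<in>E'. t e \<in> en' e) \<and> balanced en' E' t"
    and cnt: "countable C" and en: "\<And>e. e \<in> C \<Longrightarrow> card (en e) = 2"
  shows "\<exists>t. (\<forall>e\<in>C. t e \<in> en e) \<and> balanced en C t"
proof -
  obtain c :: "'e \<Rightarrow> nat" where c: "inj_on c C" using cnt by (auto simp: countable_def)
  define V where "V = \<Union> (en ` C)"
  define en' where "en' e = (case e of Inl e \<Rightarrow> (\<lambda>w. (w, c e)) ` en e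
      | Inr (w, i, j) \<Rightarrow> {(w, j), (w, Suc j)})"
    for e :: "'e + 'v \<times> nat \<times> nat"
  have en'_simps [simp]: "en' (Inl e) = (\<lambda>w. (w, c e)) ` en e" "en' (Inr (w, i, j)) = {(w, j), (w, Suc j)}"
    for e w i j by (simp_all add: en'_def)
  define E' where "E' = Inl ` C \<union> Inr ` (SIGMA w:V. SIGMA i:UNIV. {i :: nat..})"
  have E'_simps [simp]: "Inl e \<in> E' \<longleftrightarrow> e \<in> C" "Inr (w, i, j) \<in> E' \<longleftrightarrow> w \<in> V \<and> i \<le> j" for e w i j
    by (auto simp: E'_def)
  have "countable (en e)" if "e \<in> C" for e
    using en[OF that] card_ge_0_finite[of "en e"] by (simp add: countable_finite)
  then have "countable V" unfolding V_def using cnt by (rule countable_UN[rotated])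
  then have "countable E'" unfolding E'_def using cnt
    by (intro countable_Un countable_image countable_SIGMA countableI_type)
  moreover have "card (en' e) = 2" if "e \<in> E'" for e
  proof (cases e)
    case (Inl e')
    then show ?thesis using that en[of e'] by (simp add: card_image inj_on_def)
  next
    case (Inr p)
    then show ?thesis by (cases p) simp
  qed
  moreover have "finite {e \<in> E'. x \<in> en' e}" for x
  proof -
    obtain w n where x: "x = (w, n)" by (cases x)
    have "finite {e \<in> C. c e = n}"
    proof (rule finite_subset[OF _ finite.emptyI[THEN finite.insertI]])
      show "{e \<in> C. c e = n} \<subseteq> {inv_into C c n}" using c by auto
    qed
    then have "finite (Inl ` {e \<in> C. c e = n} \<union> Inr ` ({w} \<times> {..n} \<times> {..n}) :: ('e + 'v \<times> nat \<times> nat) set)"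
      by simp
    moreover have "{e \<in> E'. x \<in> en' e} \<subseteq> Inl ` {e \<in> C. c e = n} \<union> Inr ` ({w} \<times> {..n} \<times> {..n})"
    proof
      fix e assume "e \<in> {e \<in> E'. x \<in> en' e}"
      then show "e \<in> Inl ` {e \<in> C. c e = n} \<union> Inr ` ({w} \<times> {..n} \<times> {..n})"
        by (cases e) (auto simp: x)
    qed
    ultimately show ?thesis by (rule rev_finite_subset)
  qed
  ultimately obtain t' where t': "\<And>e. e \<in> E' \<Longrightarrow> t' e \<in> en' e" "balanced en' E' t'"
    using lf[of E' en'] by blast
  define t where "t e = fst (t' (Inl e))" for e
  have t't: "t' (Inl e) = (t e, c e) \<and> t e \<in> en e" if "e \<in> C" for e
    using t'(1)[of "Inl e"] that by (auto simp: t_def)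
  have "balanced en C t"
    unfolding balanced_def
  proof (intro allI impI)
    fix X u v k
    assume uv: "u \<in> X" "v \<notin> X" "linked en C k u v" and fin: "finite (out_cut en C t X)"
    \<comment> \<open>Height \<open>k\<close> is chosen because a cut through a ray at height
      \<open>k\<close> or above costs more than \<open>k\<close> edges.\<close>
    have "linked en' E' k (u, k) (v, k)"
      unfolding linked_def
    proof (intro allI impI)
      fix F assume F: "finite F" "F \<subseteq> E'" "card F < k"
      show "conn en' (E' - F) (u, k) (v, k)"
      proof (rule ccontr)
        assume "\<not> conn en' (E' - F) (u, k) (v, k)"
        then obtain X' where X': "(E' - F) \<inter> cut_edges en' X' = {}" "(u, k) \<in> X'" "(v, k) \<notin> X'"
          by (rule not_connE)
        then have cutF: "f \<in> F" if "f \<in> E'" "f \<in> cut_edges en' X'" for f using that by blast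
        define Y where "Y = {w. (w, k) \<in> X'}"
        define F' where "F' = C \<inter> cut_edges en Y"
        have "\<exists>f\<in>F. f = Inl e \<or> (\<exists>w j. f = Inr (w, c e, j))" if e: "e \<in> F'" for e
        proof -
          have eC: "e \<in> C" using e by (simp add: F'_def)
          obtain a b where ab: "a \<in> en e" "b \<in> en e" "a \<in> Y" "b \<notin> Y"
            using e unfolding F'_def by (auto elim: cut_edgesE)
          show ?thesis
          proof (cases "Inl e \<in> cut_edges en' X'")
            case True
            then show ?thesis using cutF eC by (intro bexI[of _ "Inl e"]) auto
          next
            case False
            then have "(a, c e) \<in> X' \<longleftrightarrow> (b, c e) \<in> X'" using ab(1,2) by (auto simp: cut_edges_def)
            \<comment> \<open>The ends of \<open>e\<close> agree at height \<open>c e\<close> but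
              not at height \<open>k\<close>, so one of them changes sides along its ray.\<close>
            then obtain w where w: "w \<in> en e" "((w, c e) \<in> X') \<noteq> ((w, k) \<in> X')"
              using ab by (auto simp: Y_def)
            have wV: "w \<in> V" using w(1) eC by (auto simp: V_def)
            have ray: "Inr (w, i, j) \<in> F" if "i \<le> j" "((w, j) \<in> X') \<noteq> ((w, Suc j) \<in> X')" for i j
              using that wV by (intro cutF) (auto simp: cut_edges_def)
            \<comment> \<open>If \<open>c e \<le> k\<close>, the crossed ray edge with label
              \<open>c e\<close> exists, as \<open>c e \<le> j\<close>, and determines
              \<open>e\<close>. Otherwise all \<open>Suc j > k\<close> parallel edges would lie in
              \<open>F\<close>.\<close>
            show ?thesis
            proof (cases "c e \<le> k")
              case True
              from ex_change[of _ _ "\<lambda>j. (w, j) \<in> X'", OF this w(2)]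
              obtain j where "c e \<le> j" "((w, j) \<in> X') \<noteq> ((w, Suc j) \<in> X')" by blast
              then show ?thesis using ray by blast
            next
              case False
              then obtain j where j: "k \<le> j" "((w, j) \<in> X') \<noteq> ((w, Suc j) \<in> X')"
                using ex_change[of k "c e" "\<lambda>j. (w, j) \<in> X'"] w(2) by auto
              have "(\<lambda>i. Inr (w, i, j)) ` {..j} \<subseteq> F" using ray j(2) by blast
              then have "card ((\<lambda>i. Inr (w, i, j) :: 'e + 'v \<times> nat \<times> nat) ` {..j}) \<le> card F"
                by (rule card_mono[OF F(1)])
              then have "Suc j \<le> card F" by (simp add: card_image inj_on_def)
              then show ?thesis using F(3) j(1) by simp
            qed
          qed
        qed
        then obtain g where g: "\<And>e. e \<in> F' \<Longrightarrow> g e \<in> F \<and> (g e = Inl e \<or> (\<exists>w j. g e = Inr (w, c e, j)))"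
          by metis
        have "inj_on g F'"
        proof (rule inj_onI)
          fix x y assume xy: "x \<in> F'" "y \<in> F'" "g x = g y"
          then have "x = y \<or> c x = c y" using g[OF xy(1)] g[OF xy(2)] by auto
          then show "x = y" using c xy by (auto simp: F'_def inj_on_def)
        qed
        then have "finite F'" "card F' \<le> card F"
          using g F(1) inj_on_finite[of g F' F] card_inj_on_le[of g F' F] by blast+
        then have "conn en (C - F') u v"
          using F(3) by (intro linkedD[OF uv(3)]) (auto simp: F'_def)
        moreover have "u \<in> Y" "v \<notin> Y" using X'(2,3) by (simp_all add: Y_def)
        ultimately show False using conn_crosses[of en "C - F'" u v Y] by (auto simp: F'_def)
      qed
    qed
    \<comment> \<open>A union of whole rays is crossed by no ray edge, so contracting the rays
      preserves its out-cut.\<close>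
    moreover have out: "out_cut en' E' t' (X \<times> UNIV) = Inl ` out_cut en C t X"
    proof -
      have "Inl e \<in> cut_edges en' (X \<times> UNIV) \<longleftrightarrow> e \<in> cut_edges en X" for e
        by (auto simp: cut_edges_def)
      moreover have "Inr p \<notin> cut_edges en' (X \<times> UNIV)" for p
        by (cases p) (auto simp: cut_edges_def)
      ultimately show ?thesis using t't by (auto simp: out_cut_def E'_def)
    qed
    ultimately have "k div 2 \<le> card (Inl ` out_cut en C t X :: ('e + 'v \<times> nat \<times> nat) set)"
      using balancedD[OF t'(2), of "(u, k)" "X \<times> UNIV" "(v, k)" k] uv(1,2) fin by simp
    then show "k div 2 \<le> card (out_cut en C t X)" by (simp add: card_image)
  qed
  then show ?thesis using t't by blast
qed

section \<open>From cuts to paths\<close>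

lemma is_path_conn:
  assumes "is_path G u xs es v" "set es \<subseteq> A"
  shows "conn (ends G) A u v"
proof -
  have p: "length xs = length es + 1" "hd xs = u" "last xs = v"
    "\<And>i. i < length es \<Longrightarrow> ends G (es ! i) = {xs ! i, xs ! (i + 1)}"
    using assms(1) by (simp_all add: is_path_def)
  have "i \<le> length es \<Longrightarrow> conn (ends G) A u (xs ! i)" for i
  proof (induction i)
    case 0
    then show ?case using p(1,2) by (cases xs) simp_all
  next
    case (Suc i)
    then have "conn (ends G) A (xs ! i) (xs ! Suc i)"
      using p(4)[of i] assms(2) nth_mem[of i es] by (intro conn_edge[of "es ! i"]) auto
    with Suc show ?case by (auto intro: conn_trans)
  qed
  moreover have "xs \<noteq> []" using p(1) by auto
  then have "xs ! length es = v" using p(1,3) by (simp add: last_conv_nth)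
  ultimately show ?thesis by blast
qed

text \<open>The vertices reached by paths avoiding \<open>S\<close> form a set uncrossed by the
  other edges: a path is extended by the next edge, or cut back if it already visits the new
  vertex.\<close>

lemma edge_separates_iff:
  assumes "loopless_multigraph G" "u \<in> vertices G" "S \<subseteq> edges G"
  shows "edge_separates G u v S \<longleftrightarrow> \<not> conn (ends G) (edges G - S) u v"
proof
  assume n: "\<not> conn (ends G) (edges G - S) u v"
  have "S \<inter> set es \<noteq> {}" if "is_path G u xs es v" for xs es
  proof
    assume "S \<inter> set es = {}"
    then have "set es \<subseteq> edges G - S" using that by (auto simp: is_path_def)
    then show False using is_path_conn[OF that] n by blast
  qed
  then show "edge_separates G u v S" using assms(3) by (simp add: edge_separates_def)
next
  assume sep: "edge_separates G u v S"
  define X where "X = {z. \<exists>xs es. is_path G u xs es z \<and> S \<inter> set es = {}}"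
  have "is_path G u [u] [] u" using assms(2) by (simp add: is_path_def)
  then have "u \<in> X" unfolding X_def by force
  moreover have "v \<notin> X" using sep unfolding X_def edge_separates_def by blast
  moreover have "e \<notin> cut_edges (ends G) X" if e: "e \<in> edges G - S" for e
  proof
    assume "e \<in> cut_edges (ends G) X"
    then obtain a b where ab: "a \<in> ends G e" "b \<in> ends G e" "a \<in> X" "b \<notin> X" by (rule cut_edgesE)
    have G: "ends G e \<subseteq> vertices G" "card (ends G e) = 2"
      using assms(1) e by (auto simp: loopless_multigraph_def)
    have eab: "ends G e = {a, b}" using G(2) ab by (auto simp: card_2_iff)
    obtain xs es where p: "is_path G u xs es a" "S \<inter> set es = {}" using ab(3) unfolding X_def by blast
    have len: "length xs = length es + 1" "xs \<noteq> []" using p(1) by (auto simp: is_path_def)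
    have "\<exists>xs es. is_path G u xs es b \<and> S \<inter> set es = {}"
    proof (cases "b \<in> set xs")
      case True
      then obtain i where i: "i < length xs" "xs ! i = b" by (auto simp: in_set_conv_nth)
      have "last (take (Suc i) xs) = b" using i by (simp add: take_Suc_conv_app_nth)
      moreover have "hd (take (Suc i) xs) = u" using p(1) by (simp add: is_path_def)
      ultimately have "is_path G u (take (Suc i) xs) (take i es) b"
        using p(1) i len set_take_subset[of "Suc i" xs] set_take_subset[of i es]
        by (auto simp: is_path_def)
      moreover have "S \<inter> set (take i es) = {}" using p(2) set_take_subset[of i es] by blast
      ultimately show ?thesis by blast
    next
      case False
      have "ends G ((es @ [e]) ! i) = {(xs @ [b]) ! i, (xs @ [b]) ! (i + 1)}" if "i < length (es @ [e])" for i
      proof (cases "i < length es")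
        case True
        then show ?thesis using p(1) len by (simp add: is_path_def nth_append)
      next
        case False
        then have "i = length es" using that by simp
        moreover have "xs ! length es = a"
          using p(1) len by (auto simp: is_path_def last_conv_nth)
        ultimately show ?thesis using len eab by (simp add: nth_append)
      qed
      then have "is_path G u (xs @ [b]) (es @ [e]) b"
        using p(1) e False G(1) ab(2) len by (auto simp: is_path_def)
      moreover have "S \<inter> set (es @ [e]) = {}" using p(2) e by auto
      ultimately show ?thesis by blast
    qed
    then show False using ab(4) unfolding X_def by blast
  qed
  ultimately show "\<not> conn (ends G) (edges G - S) u v"
    unfolding conn_def by blast
qed

section \<open>Directed paths and out-cuts\<close>

lemma cas_crosses:
  assumes "pre_digraph.cas D u p v" "u \<in> X" "v \<notin> X"
  shows "\<exists>e\<in>set p. tail D e \<in> X \<and> head D e \<notin> X"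
  using assms by (induction p arbitrary: u) (auto simp: pre_digraph.cas.simps)

lemma out_arcs_separate:
  assumes "u \<in> X" "v \<notin> X"
  shows "arc_separates D u v {e \<in> arcs D. tail D e \<in> X \<and> head D e \<notin> X}"
proof -
  have "\<exists>e\<in>set p. e \<in> arcs D \<and> tail D e \<in> X \<and> head D e \<notin> X" if "pre_digraph.apath D u p v" for p
    using that cas_crosses[of D u p v X] assms
    by (auto simp: pre_digraph.apath_def pre_digraph.awalk_def)
  then show ?thesis unfolding arc_separates_def by blast
qed

text \<open>\<open>X\<close> consists of the vertices reachable from \<open>u\<close> by walks
  avoiding \<open>S\<close>. Walks extend freely, and one ending in \<open>v\<close> could be
  shortened to a path.\<close>

lemma (in wf_digraph) arc_separates_out_arcs:
  assumes "arc_separates G u v S" "u \<in> verts G"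
  shows "\<exists>X. u \<in> X \<and> v \<notin> X \<and> {e \<in> arcs G. tail G e \<in> X \<and> head G e \<notin> X} \<subseteq> S"
proof (intro exI conjI)
  let ?X = "{z. \<exists>p. awalk u p z \<and> S \<inter> set p = {}}"
  show "u \<in> ?X" using assms(2) by (auto simp: awalk_Nil_iff intro: exI[of _ "[]"])
  show "v \<notin> ?X"
  proof
    assume "v \<in> ?X"
    then obtain p where p: "awalk u p v" "S \<inter> set p = {}" by blast
    then have "S \<inter> set (awalk_to_apath p) = {}" using awalk_to_apath_subset by blast
    then show False using apath_awalk_to_apath[OF p(1)] assms(1) by (auto simp: arc_separates_def)
  qed
  show "{e \<in> arcs G. tail G e \<in> ?X \<and> head G e \<notin> ?X} \<subseteq> S"
  proof
    fix e assume e: "e \<in> {e \<in> arcs G. tail G e \<in> ?X \<and> head G e \<notin> ?X}"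
    then obtain p where p: "awalk u p (tail G e)" "S \<inter> set p = {}" by blast
    have "awalk (tail G e) [e] (head G e)" using e by (simp add: awalk_simps)
    then have "awalk u (p @ [e]) (head G e)" by (rule awalk_appendI[OF p(1)])
    then have "\<not> S \<inter> set (p @ [e]) = {}" using e by blast
    then show "e \<in> S" using p(2) by auto
  qed
qed

section \<open>Transfer to the given types\<close>

lemma card_le_of_ordLeq:
  assumes "finite B" "|A| \<le>o |B|"
  shows "card A \<le> card B"
proof -
  obtain f where "inj_on f A" "f ` A \<subseteq> B" using assms(2) card_of_ordLeq[of A B] by blast
  then show ?thesis using assms(1) card_inj_on_le by blast
qed

text \<open>The locally finite graphs of the hypothesis live on arbitrary infinite types; countable
  graphs fit into any of these.\<close>

lemma ex_inj_on_infinite_type: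
  assumes "countable A"
  shows "\<exists>f :: 'a \<Rightarrow> 'b :: infinite. inj_on f A"
proof -
  obtain g :: "nat \<Rightarrow> 'b" where g: "inj g"
    using infinite_countable_subset[OF infinite_UNIV] by blast
  have "inj_on (g \<circ> to_nat_on A) A"
    using inj_on_to_nat_on[OF assms] g by (auto intro: comp_inj_on inj_on_subset)
  then show ?thesis by blast
qed

lemma conn_image:
  assumes "conn en A u v" "\<And>e. e \<in> A \<Longrightarrow> \<psi> e \<in> A' \<and> en' (\<psi> e) = \<phi> ` en e"
  shows "conn en' A' (\<phi> u) (\<phi> v)"
  unfolding conn_def
proof (intro allI impI)
  fix X assume X: "A' \<inter> cut_edges en' X = {}"
  have "e \<notin> cut_edges en (\<phi> -` X)" if "e \<in> A" for e
    using assms(2)[OF that] X unfolding cut_edges_def by blast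
  then have "A \<inter> cut_edges en (\<phi> -` X) = {}" by blast
  then show "\<phi> u \<in> X \<longleftrightarrow> \<phi> v \<in> X" using assms(1) unfolding conn_def by blast
qed

text \<open>Copy the graph into the types \<open>'a\<close> and \<open>'b\<close>, orient the copy
  by hypothesis, and pull the tails back. Its vertices are the ends of edges, which suffices because
  linked pairs with \<open>k > 0\<close> lie among them.\<close>

lemma locally_finite_balanced:
  fixes en :: "'e \<Rightarrow> 'v set"
  assumes lf: "\<And>H :: ('a::infinite, 'b::infinite) multigraph.
      loopless_multigraph H \<Longrightarrow> locally_finite H \<Longrightarrow> has_well_balanced_orientation H"
    and cnt: "countable E" and en: "\<And>e. e \<in> E \<Longrightarrow> card (en e) = 2"
    and deg: "\<And>v. finite {e \<in> E. v \<in> en e}"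
  shows "\<exists>t. (\<forall>e\<in>E. t e \<in> en e) \<and> balanced en E t"
proof -
  define V where "V = \<Union> (en ` E)"
  have "countable (en e)" if "e \<in> E" for e
    using en[OF that] card_ge_0_finite[of "en e"] by (simp add: countable_finite)
  then have "countable V" unfolding V_def using cnt by (rule countable_UN[rotated])
  then obtain \<phi> :: "'v \<Rightarrow> 'a" where \<phi>: "inj_on \<phi> V" using ex_inj_on_infinite_type by blast
  obtain \<psi> :: "'e \<Rightarrow> 'b" where \<psi>: "inj_on \<psi> E" using ex_inj_on_infinite_type[OF cnt] by blast
  have enV: "en e \<subseteq> V" if "e \<in> E" for e using that by (auto simp: V_def)
  define H where "H = \<lparr>vertices = \<phi> ` V, edges = \<psi> ` E, ends = \<lambda>b. \<phi> ` en (inv_into E \<psi> b)\<rparr>"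
  have H: "vertices H = \<phi> ` V" "edges H = \<psi> ` E" by (simp_all add: H_def)
  have endsH: "ends H (\<psi> e) = \<phi> ` en e" if "e \<in> E" for e
    using that \<psi> by (simp add: H_def)
  have loop: "loopless_multigraph H"
    unfolding loopless_multigraph_def
  proof
    fix b assume "b \<in> edges H"
    then obtain e where e: "e \<in> E" "b = \<psi> e" by (auto simp: H)
    have "card (\<phi> ` en e) = 2"
      using en[OF e(1)] card_image[OF inj_on_subset[OF \<phi> enV[OF e(1)]]] by simp
    then show "ends H b \<subseteq> vertices H \<and> card (ends H b) = 2"
      using e enV[OF e(1)] by (auto simp: endsH H)
  qed
  moreover have "locally_finite H"
    unfolding locally_finite_def
  proof
    fix x assume "x \<in> vertices H"
    then obtain v where v: "v \<in> V" "x = \<phi> v" by (auto simp: H)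
    have "{b \<in> edges H. x \<in> ends H b} \<subseteq> \<psi> ` {e \<in> E. v \<in> en e}"
    proof
      fix b assume "b \<in> {b \<in> edges H. x \<in> ends H b}"
      then obtain e where e: "e \<in> E" "b = \<psi> e" "\<phi> v \<in> \<phi> ` en e" by (auto simp: H endsH v)
      then have "v \<in> en e" using \<phi> v(1) enV[OF e(1)] by (auto dest: inj_onD)
      then show "b \<in> \<psi> ` {e \<in> E. v \<in> en e}" using e by blast
    qed
    then show "finite {b \<in> edges H. x \<in> ends H b}" using deg[of v] finite_subset by blast
  qed
  ultimately have "has_well_balanced_orientation H" by (rule lf)
  then obtain D where D: "is_orientation H D" "well_balanced H D"
    by (auto simp: has_well_balanced_orientation_def)
  have arcsD: "arcs D = \<psi> ` E" and ends: "\<And>e. e \<in> E \<Longrightarrow> {tail D (\<psi> e), head D (\<psi> e)} = \<phi> ` en e"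
    using D(1) by (auto simp: is_orientation_def H endsH)
  define t where "t e = inv_into V \<phi> (tail D (\<psi> e))" for e
  have t: "\<phi> (t e) = tail D (\<psi> e) \<and> t e \<in> en e" if e: "e \<in> E" for e
  proof -
    obtain x where x: "x \<in> en e" "tail D (\<psi> e) = \<phi> x" using ends[OF e] by blast
    then have "t e = x" using \<phi> enV[OF e] by (auto simp: t_def)
    then show ?thesis using x by simp
  qed
  have "balanced en E t"
    unfolding balanced_def
  proof (intro allI impI)
    fix X u v k
    assume uv: "u \<in> X" "v \<notin> X" "linked en E k u v" and fin: "finite (out_cut en E t X)"
    show "k div 2 \<le> card (out_cut en E t X)"
    proof (cases "k = 0")
      case False
      have "conn en (E - {}) u v" using False by (intro linkedD[OF uv(3)]) auto
      then have "conn en E u v" by simp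
      moreover have "u \<noteq> v" using uv by blast
      ultimately have V: "u \<in> V" "v \<in> V"
        using conn_in_ends[of en E u v] conn_in_ends[of en E v u] conn_sym unfolding V_def by metis+
      let ?X = "\<phi> ` (X \<inter> V)"
      let ?O = "{b \<in> arcs D. tail D b \<in> ?X \<and> head D b \<notin> ?X}"
      have sub: "?O \<subseteq> \<psi> ` out_cut en E t X"
      proof
        fix b assume b: "b \<in> ?O"
        then obtain e where e: "e \<in> E" "b = \<psi> e" by (auto simp: arcsD)
        obtain d where d: "d \<in> en e" "head D b = \<phi> d" using ends[OF e(1)] e(2) by blast
        have "d \<notin> X" using b d enV[OF e(1)] by blast
        moreover have "t e \<in> X"
        proof -
          obtain x where x: "x \<in> X" "x \<in> V" "tail D b = \<phi> x" using b by blast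
          then have "\<phi> (t e) = \<phi> x" using t[OF e(1)] e(2) by simp
          then have "t e = x" using \<phi> x(2) t[OF e(1)] enV[OF e(1)] by (auto dest: inj_onD)
          then show ?thesis using x(1) by simp
        qed
        ultimately have "e \<in> out_cut en E t X"
          using e(1) t[OF e(1)] d(1) cut_edgesI[of "t e" en e d X] by (simp add: out_cut_def)
        then show "b \<in> \<psi> ` out_cut en E t X" using e(2) by blast
      qed
      have finO: "finite ?O" using sub fin finite_subset by blast
      have "card ?O \<le> card (\<psi> ` out_cut en E t X)" using sub fin by (intro card_mono) auto
      then have cardO: "card ?O \<le> card (out_cut en E t X)" using card_image_le[OF fin] order_trans by blast
      have \<phi>uv: "\<phi> u \<in> ?X" "\<phi> v \<notin> ?X" using V uv(1,2) \<phi> by (auto dest: inj_onD)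
      have ne: "\<phi> u \<noteq> \<phi> v"
      proof
        assume "\<phi> u = \<phi> v"
        with \<phi>uv(1) have "\<phi> v \<in> ?X" by (rule subst[rotated])
        with \<phi>uv(2) show False by contradiction
      qed
      have "floor_half (edge_conn H (\<phi> u) (\<phi> v)) \<le>o arc_conn D (\<phi> u) (\<phi> v)"
        using D(2) V ne by (auto simp: well_balanced_def H)
      moreover have "arc_conn D (\<phi> u) (\<phi> v) \<le>o |?O|"
        unfolding arc_conn_def using out_arcs_separate[OF \<phi>uv] by (intro min_card_le) simp
      ultimately have le: "floor_half (edge_conn H (\<phi> u) (\<phi> v)) \<le>o |?O|" by (rule ordLeq_transitive)
      have "{S. edge_separates H (\<phi> u) (\<phi> v) S} \<noteq> {}" using edge_separates_edges[OF ne] by blast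
      from min_card_attained[OF this] obtain S
        where S: "edge_separates H (\<phi> u) (\<phi> v) S" "edge_conn H (\<phi> u) (\<phi> v) = |S|"
        unfolding edge_conn_def by blast
      have SH: "S \<subseteq> edges H" using S(1) by (simp add: edge_separates_def)
      \<comment> \<open>An infinite minimum separator is not halved and would force
        \<open>?O\<close> to be infinite.\<close>
      have finS: "finite S"
      proof (rule ccontr)
        assume inf: "infinite S"
        have "|S| \<le>o |?O|" using le unfolding S(2) floor_half_infinite[OF inf] .
        then show False using finO inf card_of_ordLeq_finite by blast
      qed
      then obtain B where B: "floor_half |S| = |B|" "finite B" "card B = card S div 2"
        using floor_half_finite by blast
      have "|B| \<le>o |?O|" using le S(2) B(1) by simp
      then have "card B \<le> card ?O" by (rule card_le_of_ordLeq[OF finO])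
      then have "card S div 2 \<le> card (out_cut en E t X)" using B(3) cardO by simp
      \<comment> \<open>A smaller \<open>S\<close> would pull back to fewer than \<open>k\<close>
        edges separating \<open>u\<close> from \<open>v\<close>.\<close>
      moreover have "k \<le> card S"
      proof (rule ccontr)
        assume "\<not> k \<le> card S"
        define F where "F = {e \<in> E. \<psi> e \<in> S}"
        have "inj_on \<psi> F" "\<psi> ` F \<subseteq> S" using inj_on_subset[OF \<psi>] by (auto simp: F_def)
        then have "finite F" "card F \<le> card S"
          using finS inj_on_finite[of \<psi> F S] card_inj_on_le[of \<psi> F S] by blast+
        then have "conn en (E - F) u v"
          using \<open>\<not> k \<le> card S\<close> by (intro linkedD[OF uv(3)]) (auto simp: F_def)
        then have "conn (ends H) (edges H - S) (\<phi> u) (\<phi> v)"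
          by (rule conn_image[where \<psi>=\<psi>]) (auto simp: F_def H endsH)
        then show False using S(1) V edge_separates_iff[OF loop _ SH] by (auto simp: H)
      qed
      ultimately show ?thesis by (meson div_le_mono order_trans)
    qed simp
  qed
  then show ?thesis using t by blast
qed

section \<open>Assembling the orientation of the whole graph\<close>

theorem theorem4p1:
  fixes G :: "('v, 'e) multigraph"
  assumes "\<And>H :: ('a::infinite, 'b::infinite) multigraph.
             loopless_multigraph H \<Longrightarrow> locally_finite H \<Longrightarrow> has_well_balanced_orientation H"
    and "loopless_multigraph G"
  shows "has_well_balanced_orientation G"
proof -
  let ?E = "edges G" and ?en = "ends G"
  have en: "card (?en e) = 2" "?en e \<subseteq> vertices G" if "e \<in> ?E" for e
    using assms(2) that by (auto simp: loopless_multigraph_def)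
  have "finite (?en e)" if "e \<in> ?E" for e
    using en(1)[OF that] card_ge_0_finite[of "?en e"] by simp
  then have "\<exists>P. \<Union>P = ?E \<and> pairwise disjnt P \<and> (\<forall>A\<in>P. countable A \<and> faithful ?en A ?E)"
    by (rule countable_faithful_partition)
  then obtain P where "\<Union>P = ?E \<and> pairwise disjnt P \<and> (\<forall>A\<in>P. countable A \<and> faithful ?en A ?E)" ..
  then have P: "\<Union>P = ?E" "pairwise disjnt P"
    and PA: "\<And>A. A \<in> P \<Longrightarrow> countable A" "\<And>A. A \<in> P \<Longrightarrow> faithful ?en A ?E" by simp_all
  have "\<exists>t. (\<forall>e\<in>A. t e \<in> ?en e) \<and> balanced ?en A t" if A: "A \<in> P" for A
  proof (rule countable_balanced)
    show "countable A" by (rule PA(1)[OF A])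
    show "card (?en e) = 2" if "e \<in> A" for e using that A P(1) by (intro en(1)) blast
    show "\<exists>t. (\<forall>e\<in>E'. t e \<in> en' e) \<and> balanced en' E' t"
      if "countable E'" "\<And>e. e \<in> E' \<Longrightarrow> card (en' e) = 2" "\<And>x. finite {e \<in> E'. x \<in> en' e}"
      for E' :: "('e + 'v \<times> nat \<times> nat) set" and en' :: "_ \<Rightarrow> ('v \<times> nat) set"
      using assms(1) that by (rule locally_finite_balanced)
  qed
  then have "\<forall>A\<in>P. \<exists>t. (\<forall>e\<in>A. t e \<in> ?en e) \<and> balanced ?en A t" by (rule ballI)
  from bchoice[OF this] obtain T where "\<forall>A\<in>P. (\<forall>e\<in>A. T A e \<in> ?en e) \<and> balanced ?en A (T A)" ..
  then have T: "\<And>A e. A \<in> P \<Longrightarrow> e \<in> A \<Longrightarrow> T A e \<in> ?en e" "\<And>A. A \<in> P \<Longrightarrow> balanced ?en A (T A)"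
    by simp_all
  \<comment> \<open>Pieces are disjoint, so the piece chosen for an edge is the only one containing
    it.\<close>
  define t where "t e = T (SOME A. A \<in> P \<and> e \<in> A) e" for e
  have tT: "t e = T A e" if "A \<in> P" "e \<in> A" for A e
  proof -
    have "(SOME A. A \<in> P \<and> e \<in> A) = A"
      by (rule some_equality) (use that P(2) in \<open>auto simp: pairwise_def disjnt_def\<close>)
    then show ?thesis by (simp add: t_def)
  qed
  have t: "t e \<in> ?en e" if "e \<in> ?E" for e using that P(1) tT T(1) by (metis UnionE)
  have balA: "balanced ?en A t" if A: "A \<in> P" for A
  proof -
    have "out_cut ?en A t X = out_cut ?en A (T A) X" for X using tT[OF A] by (auto simp: out_cut_def)
    then show ?thesis using T(2)[OF A] by (simp add: balanced_def)
  qed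
  have bal: "balanced ?en ?E t" by (rule balanced_Union[OF P PA(2) balA])
  define D where "D = \<lparr>verts = vertices G, arcs = ?E, tail = t, head = \<lambda>e. the_elem (?en e - {t e})\<rparr>"
  have D: "verts D = vertices G" "arcs D = ?E" "tail D = t" by (simp_all add: D_def)
  have ends: "{t e, head D e} = ?en e" if e: "e \<in> ?E" for e
  proof -
    have "card (?en e - {t e}) = 1" using en(1)[OF e] t[OF e] by simp
    then obtain h where h: "?en e - {t e} = {h}" by (auto simp: card_1_singleton_iff)
    then have "head D e = h" by (simp add: D_def)
    then show ?thesis using h t[OF e] by blast
  qed
  have ori: "is_orientation G D" using ends by (simp add: is_orientation_def D)
  have "t e \<in> vertices G" "head D e \<in> vertices G" if "e \<in> ?E" for e
    using ends[OF that] en(2)[OF that] by blast+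
  then interpret D: wf_digraph D by unfold_locales (simp_all add: D)
  have "floor_half (edge_conn G u v) \<le>o arc_conn D u v"
    if u: "u \<in> vertices G" and v: "v \<in> vertices G" and ne: "u \<noteq> v" for u v
  proof -
    have "{S. arc_separates D u v S} \<noteq> {}" using arc_separates_arcs[OF ne] by blast
    from min_card_attained[OF this] obtain S where S: "arc_separates D u v S" "arc_conn D u v = |S|"
      unfolding arc_conn_def by blast
    \<comment> \<open>A minimum directed separator contains the out-cut of some \<open>X\<close>, so
      it suffices to bound out-cuts from below.\<close>
    obtain X where X: "u \<in> X" "v \<notin> X" "{e \<in> arcs D. tail D e \<in> X \<and> head D e \<notin> X} \<subseteq> S"
      using D.arc_separates_out_arcs[OF S(1)] u by (auto simp: D)
    let ?O = "out_cut ?en ?E t X"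
    have "?O \<subseteq> S"
    proof
      fix e assume e: "e \<in> ?O"
      then have eE: "e \<in> ?E" "t e \<in> X" by (simp_all add: out_cut_def)
      have "\<not> {t e, head D e} \<subseteq> X"
        unfolding ends[OF eE(1)] using e by (auto simp: out_cut_def cut_edges_def)
      then have "head D e \<notin> X" using eE(2) by simp
      then show "e \<in> S" using X(3) eE by (auto simp: D)
    qed
    then have OS: "|?O| \<le>o |S|" by (rule card_of_mono1)
    have "{S. edge_separates G u v S} \<noteq> {}" using edge_separates_edges[OF ne] by blast
    from min_card_attained[OF this] obtain C where C: "edge_conn G u v = |C|"
      unfolding edge_conn_def by blast
    have sep: "|C| \<le>o |F|" if "F \<subseteq> ?E" "\<not> conn ?en (?E - F) u v" for F
      unfolding C[symmetric] edge_conn_def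
      using that edge_separates_iff[OF assms(2) u] by (intro min_card_le) simp
    \<comment> \<open>For infinite \<open>C\<close> the premise holds for every \<open>k\<close>, so
      the pair is linked for all \<open>k\<close>.\<close>
    have linked: "linked ?en ?E k u v" if "finite C \<Longrightarrow> k \<le> card C" for k
      unfolding linked_def
    proof (intro allI impI, rule ccontr)
      fix F assume F: "finite F" "F \<subseteq> ?E" "card F < k" "\<not> conn ?en (?E - F) u v"
      then have CF: "|C| \<le>o |F|" by (intro sep)
      then have "finite C" using F(1) card_of_ordLeq_finite by blast
      moreover have "card C \<le> card F" by (rule card_le_of_ordLeq[OF F(1) CF])
      ultimately show False using that F(3) by simp
    qed
    have "floor_half |C| \<le>o |?O|"
    proof (cases "finite C")
      case True
      then obtain B where B: "floor_half |C| = |B|" "finite B" "card B = card C div 2"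
        using floor_half_finite by blast
      have "|B| \<le>o |?O|"
      proof (cases "finite ?O")
        case fin: True
        have "card C div 2 \<le> card ?O"
          using balancedD[OF bal X(1,2) linked[of "card C"] fin] by simp
        then show ?thesis using B(2,3) fin card_le_inj[of B ?O] card_of_ordLeq[of B ?O] by auto
      next
        case False
        then show ?thesis using B(2) by (intro countable_ordLeq_infinite countable_finite)
      qed
      then show ?thesis by (simp add: B(1))
    next
      case False
      have "|C| \<le>o |?O|"
      proof (cases "countable C")
        case True
        have "infinite ?O"
        proof
          assume fin: "finite ?O"
          \<comment> \<open>Half of this value exceeds \<open>card ?O\<close>, so \<open>?O\<close>
            cannot be finite.\<close>
          have "linked ?en ?E (2 * Suc (card ?O)) u v" using False by (intro linked) simp
          from balancedD[OF bal X(1,2) this fin] show False by simp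
        qed
        with True show ?thesis by (rule countable_ordLeq_infinite)
      next
        case False
        show ?thesis
          by (rule uncountable_out_cut[OF en(1) P PA(2,1) balA X(1,2) False sep])
      qed
      then show ?thesis using False by (simp add: floor_half_infinite)
    qed
    then show ?thesis unfolding C S(2) using OS by (rule ordLeq_transitive)
  qed
  then have "well_balanced G D" by (simp add: well_balanced_def)
  then show ?thesis using ori by (auto simp: has_well_balanced_orientation_def)
qed

end
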